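(* Let $\mathbb F$ be an algebraically closed field and let $q\in\mathbb F$ be nonzero and not a root of unity. Let $V$ be an evaluation module for $\boxtimes_q$, with diameter $d$ and evaluation parameter $t$. There exists an exchanger $\mathcal X$ for $V$ that is described as follows. In the table below, each row contains a basis for $V$ and the entries of a matrix in ${\rm Mat}_{d+1}(\mathbb F)$. The matrix represents $\mathcal X$ with respect to the basis. $$\begin{array}{c|c}\text{basis}&(i,j)\text{-entry for }0\le i,j\le d\\ \hline [0,2,1,3]&\delta_{i+j,d}\,t^iq^{i(d-1)-\binom d2}\\ [0,2,3,1]&\delta_{i+j,d}\,t^{d-i}q^{\binom d2-i(d-1)}\\ [2,0,3,1]&\delta_{i+j,d}\,t^iq^{i(d-1)-\binom d2}\\ [2,0,1,3]&\delta_{i+j,d}\,t^{d-i}q^{\binom d2-i(d-1)}\\ [1,3,2,0]&\delta_{i+j,d}(-1)^dt^{d-i}q^{i(d-1)-\binom d2}\\ [1,3,0,2]&\delta_{i+j,d}(-1)^dt^iq^{\binom d2-i(d-1)}\\ [3,1,0,2]&\delta_{i+j,d}(-1)^dt^{d-i}q^{i(d-1)-\binom d2}\\ [3,1,2,0]&\delta_{i+j,d}(-1)^dt^iq^{\binom d2-i(d-1)}\end{array}$$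
   Context: Algebras are associative with 1. $[n]_q=(q^n-q^{-n})/(q-q^{-1})$ and $\mathbb Z_4=\mathbb Z/4\mathbb Z$. The $q$-tetrahedron algebra $\boxtimes_q$ is the $\mathbb F$-algebra with generators (called the standard generators) $\{x_{ij}\mid i,j\in\mathbb Z_4,\ j-i=1\text{ or }j-i=2\}$ and relations: (i) $x_{ij}x_{ji}=1$ if $j-i=2$; (ii) $\frac{qx_{ij}x_{jk}-q^{-1}x_{jk}x_{ij}}{q-q^{-1}}=1$ if $(j-i,k-j)$ is one of $(1,1),(1,2),(2,1)$; (iii) $x_{ij}^3x_{k\ell}-[3]_qx_{ij}^2x_{k\ell}x_{ij}+[3]_qx_{ij}x_{k\ell}x_{ij}^2-x_{k\ell}x_{ij}^3=0$ if $j-i=k-j=\ell-k=1$. Known fact: on a finite-dimensional irreducible $\boxtimes_q$-module $V$ there are $d\in\mathbb N$ (the diameter) and $\varepsilon\in\{1,-1\}$ (the type) such that each standard generator is diagonalizable with set of distinct eigenvalues $\{\varepsilon q^{d-2n}\mid 0\le n\le d\}$. Let $V$ have type 1. For distinct $i,j\in\mathbb Z_4$ the decomposition $[i,j]$ of $V$ is the sequence of subspaces $\{V_n\}_{n=0}^d$ (with $V=\bigoplus_n V_n$) such that: if $j-i\in\{1,2\}$, $V_n$ is the eigenspace of $x_{ij}$ with eigenvalue $q^{d-2n}$; if $j-i=3$, $[i,j]$ is the inversion (reversed sequence) of $[j,i]$. The shape $(\dim V_n)_{n=0}^d$ does not depend on $i,j$. For $i\in\mathbb Z_4$ the flag $[i]$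 on $V$ has $n$th component $V_0+\cdots+V_n$, where $\{V_n\}$ is the decomposition $[i,j]$; this is known not to depend on $j\ne i$. The trivial $\boxtimes_q$-module is the one-dimensional module on which every standard generator acts as the identity. An evaluation module for $\boxtimes_q$ is a nontrivial finite-dimensional irreducible $\boxtimes_q$-module of type 1 and shape $(1,1,\dots,1)$ (so $d\ge1$, $\dim V=d+1$). Fix nonzero vectors $\eta_j$ in component $0$ of the flag $[j]$ on $V$ ($j\in\mathbb Z_4$). For mutually distinct $i,j,k,\ell\in\mathbb Z_4$, $[i,j,k,\ell]$ denotes the unique basis $\{u_n\}_{n=0}^d$ of $V$ such that $u_n$ is in component $n$ of the decomposition $[k,\ell]$ of $V$ for $0\le n\le d$, and $\eta_j=\sum_{n=0}^du_n$. An exchanger for $V$ is an invertible $X\in{\rm End}(V)$ such that $Xx_{ij}X^{-1}=x_{i+2,j+2}$ holds on $V$ for each standard generator $x_{ij}$. Matrices in ${\rm Mat}_{d+1}(\mathbb F)$ have rows and columns indexed by $0,\dots,d$; $M$ represents $A$ with respect to $\{v_n\}_{n=0}^d$ when $Av_n=\sum_i M_{in}v_i$. Entries not mentioned below are $0$. A subscript $q^{-1}$ means that $q$ is replaced by $q^{-1}$ in the definition (and similarly $t^{-1}$ as argument). - $Z$: $(i,j)$-entry $\delta_{i+j,d}$. - $K_q$: diagonal, $(i,i)$-entry $q^{d-2i}$. - $E_q$: $(i,i)$-entry $q^{2i-d}$; $(i-1,i)$-entry $q^d-q^{2i-2-d}$. - $G_q(t)$: $(i,i)$-entry $q^{2i-d}$;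 $(i-1,i)$-entry $(q^d-q^{2i-2-d})(1-tq^{d-2i+1})$. - $L_q(t)$: $(i,i)$-entry $q^{2i-d}$; $(i-1,i)$-entry $(q^d-q^{2i-2-d})(1-tq^{d-2i+1})^{-1}$. - $S_q(t)$: $(i-1,i)$-entry $(q^d-q^{2i-d-2})(1-tq^{2i-d-1})$; $(i,i-1)$-entry $(q^{2i-d}-q^{-d})q^{2i-d-1}t$; $(i,i)$-entry $q^d-(q^{2i-d}-q^{-d})q^{2i-d-1}t-(q^d-q^{2i-d})(1-tq^{2i-d+1})$. For an integer $d\ge1$ and a nonzero $t\in\mathbb F$ not among $\{q^{d-2n+1}\}_{n=1}^d$, $\mathbf V_d(t)$ is the evaluation module for $\boxtimes_q$ having a basis with respect to which the standard generators are represented by: $x_{01}: ZS_{q^{-1}}(t^{-1})Z$, $x_{12}: E_q$, $x_{23}: K_q$, $x_{30}: ZG_{q^{-1}}(t)Z$, $x_{02}: L_q(t)$, $x_{13}: (ZE_{q^{-1}}Z)^{-1}$, $x_{20}: (L_q(t))^{-1}$, $x_{31}: ZE_{q^{-1}}Z$. Every evaluation module $V$ of diameter $d$ is isomorphic to $\mathbf V_d(t)$ for a unique such $t$, called the evaluation parameter of $V$. *)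

theory Defs
  imports
    "HOL-Computational_Algebra.Polynomial"
    "HOL-Library.Numeral_Type"
    "Jordan_Normal_Form.Matrix"
    "Jordan_Normal_Form.Gauss_Jordan_Elimination"
begin

definition qint :: "'f::field \<Rightarrow> int \<Rightarrow> 'f" where
  "qint q n = (q powi n - q powi (- n)) / (q - inverse q)"

text \<open>Index arithmetic in the type \<open>4\<close> is arithmetic modulo 4.\<close>

definition standard :: "4 \<Rightarrow> 4 \<Rightarrow> bool" where
  "standard i j \<longleftrightarrow> j - i = 1 \<or> j - i = 2"

text \<open>A locale of its own, since definitions added to \<open>vector_space\<close> would be inherited by its
  global interpretation for real vector spaces.\<close>

locale vspace = vector_space scale
  for scale :: "'f::field \<Rightarrow> 'v::ab_group_add \<Rightarrow> 'v" (infixr "*s" 75)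
begin

definition finite_dimensional :: bool where
  "finite_dimensional \<longleftrightarrow> (\<exists>B. finite B \<and> span B = UNIV)"

definition eigenspace :: "('v \<Rightarrow> 'v) \<Rightarrow> 'f \<Rightarrow> 'v set" where
  "eigenspace f c = {v. f v = c *s v}"

definition eigenvalues :: "('v \<Rightarrow> 'v) \<Rightarrow> 'f set" where
  "eigenvalues f = {c. \<exists>v. v \<noteq> 0 \<and> f v = c *s v}"

definition diagonalizable :: "('v \<Rightarrow> 'v) \<Rightarrow> bool" where
  "diagonalizable f \<longleftrightarrow> span (\<Union>c. eigenspace f c) = UNIV"

definition indexed_basis :: "nat \<Rightarrow> (nat \<Rightarrow> 'v) \<Rightarrow> bool" where
  "indexed_basis d v \<longleftrightarrow>
     inj_on v {..d} \<and> independent (v ` {..d}) \<and> span (v ` {..d}) = UNIV"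

definition represents :: "nat \<Rightarrow> 'f mat \<Rightarrow> (nat \<Rightarrow> 'v) \<Rightarrow> ('v \<Rightarrow> 'v) \<Rightarrow> bool" where
  "represents d M v A \<longleftrightarrow>
     M \<in> carrier_mat (d + 1) (d + 1) \<and> indexed_basis d v \<and>
     (\<forall>n\<le>d. A (v n) = (\<Sum>i\<le>d. M $$ (i, n) *s v i))"

end

text \<open>In the matrices below the superdiagonal entry at \<open>(i - 1, i)\<close> is written in terms of the
  column index, the subdiagonal entry at \<open>(i, i - 1)\<close> in terms of the row index.\<close>

definition antidiag_mat :: "nat \<Rightarrow> (nat \<Rightarrow> 'f::field) \<Rightarrow> 'f mat" where
  "antidiag_mat d f = mat (d + 1) (d + 1) (\<lambda>(i, j). if i + j = d then f i else 0)"

definition Z_mat :: "nat \<Rightarrow> 'f::field mat" where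
  "Z_mat d = antidiag_mat d (\<lambda>_. 1)"

definition K_mat :: "nat \<Rightarrow> 'f::field \<Rightarrow> 'f mat" where
  "K_mat d q = mat (d + 1) (d + 1)
     (\<lambda>(r, c). if r = c then q powi (int d - 2 * int r) else 0)"

definition E_mat :: "nat \<Rightarrow> 'f::field \<Rightarrow> 'f mat" where
  "E_mat d q = mat (d + 1) (d + 1)
     (\<lambda>(r, c). if r = c then q powi (2 * int r - int d)
        else if c = r + 1 then q powi int d - q powi (2 * int c - 2 - int d)
        else 0)"

definition G_mat :: "nat \<Rightarrow> 'f::field \<Rightarrow> 'f \<Rightarrow> 'f mat" where
  "G_mat d q t = mat (d + 1) (d + 1)
     (\<lambda>(r, c). if r = c then q powi (2 * int r - int d)
        else if c = r + 1 then
          (q powi int d - q powi (2 * int c - 2 - int d)) *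
          (1 - t * q powi (int d - 2 * int c + 1))
        else 0)"

definition L_mat :: "nat \<Rightarrow> 'f::field \<Rightarrow> 'f \<Rightarrow> 'f mat" where
  "L_mat d q t = mat (d + 1) (d + 1)
     (\<lambda>(r, c). if r = c then q powi (2 * int r - int d)
        else if c = r + 1 then
          (q powi int d - q powi (2 * int c - 2 - int d)) *
          inverse (1 - t * q powi (int d - 2 * int c + 1))
        else 0)"

definition S_mat :: "nat \<Rightarrow> 'f::field \<Rightarrow> 'f \<Rightarrow> 'f mat" where
  "S_mat d q t = mat (d + 1) (d + 1)
     (\<lambda>(r, c). if c = r + 1 then
          (q powi int d - q powi (2 * int c - int d - 2)) *
          (1 - t * q powi (2 * int c - int d - 1))
        else if r = c + 1 then
          (q powi (2 * int r - int d) - q powi (- int d)) * q powi (2 * int r - int d - 1) * t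
        else if r = c then
          q powi int d
          - (q powi (2 * int r - int d) - q powi (- int d)) * q powi (2 * int r - int d - 1) * t
          - (q powi int d - q powi (2 * int r - int d)) * (1 - t * q powi (2 * int r - int d + 1))
        else 0)"

text \<open>A module for the \<open>q\<close>-tetrahedron algebra, given by its presentation: a vector space together
  with linear operators \<open>x i j\<close>, the actions of the standard generators, that satisfy the defining
  relations. Only the \<open>x i j\<close> with \<open>standard i j\<close> are meaningful. The vector space
  is the whole type \<open>'v\<close>.\<close>

locale qtet_module = vspace scale
  for scale :: "'f::field \<Rightarrow> 'v::ab_group_add \<Rightarrow> 'v" (infixr "*s" 75) +
  fixes q :: 'f and x :: "4 \<Rightarrow> 4 \<Rightarrow> 'v \<Rightarrow> 'v"
  assumes linear_x: "standard i j \<Longrightarrow> Vector_Spaces.linear scale scale (x i j)"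
    and rel_inverse: "j - i = 2 \<Longrightarrow> x i j (x j i v) = v"
    and rel_q_Weyl: "(j - i, k - j) \<in> {(1, 1), (1, 2), (2, 1)} \<Longrightarrow>
      inverse (q - inverse q) *s (q *s x i j (x j k v) - inverse q *s x j k (x i j v)) = v"
    and rel_q_Serre: "j - i = 1 \<Longrightarrow> k - j = 1 \<Longrightarrow> l - k = 1 \<Longrightarrow>
      (x i j ^^ 3) (x k l v)
      - qint q 3 *s (x i j ^^ 2) (x k l (x i j v))
      + qint q 3 *s x i j (x k l ((x i j ^^ 2) v))
      - x k l ((x i j ^^ 3) v) = 0"
begin

definition irreducible_module :: bool where
  "irreducible_module \<longleftrightarrow> (UNIV :: 'v set) \<noteq> {0} \<and>
     (\<forall>W. subspace W \<and> (\<forall>i j. standard i j \<longrightarrow> x i j ` W \<subseteq> W) \<longrightarrow> W = {0} \<or> W = UNIV)"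

definition trivial_module :: bool where
  "trivial_module \<longleftrightarrow> dim UNIV = 1 \<and> (\<forall>i j. standard i j \<longrightarrow> x i j = id)"

definition diameter_type :: "nat \<Rightarrow> 'f \<Rightarrow> bool" where
  "diameter_type d \<epsilon> \<longleftrightarrow> \<epsilon> \<in> {1, - 1} \<and>
     (\<forall>i j. standard i j \<longrightarrow>
        diagonalizable (x i j) \<and>
        eigenvalues (x i j) = {\<epsilon> * q powi (int d - 2 * int n) | n. n \<le> d})"

text \<open>The decomposition \<open>[i,j]\<close> of a module of type 1 and diameter \<open>d\<close>, for \<open>i \<noteq> j\<close>
  (the final case is \<open>j - i = 3\<close>).\<close>

definition decomp :: "nat \<Rightarrow> 4 \<Rightarrow> 4 \<Rightarrow> nat \<Rightarrow> 'v set" where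
  "decomp d i j n =
     (if standard i j then eigenspace (x i j) (q powi (int d - 2 * int n))
      else eigenspace (x j i) (q powi (int d - 2 * int (d - n))))"

definition has_shape :: "nat \<Rightarrow> (nat \<Rightarrow> nat) \<Rightarrow> bool" where
  "has_shape d s \<longleftrightarrow> (\<forall>i j. i \<noteq> j \<longrightarrow> (\<forall>n\<le>d. dim (decomp d i j n) = s n))"

text \<open>The flag \<open>[i]\<close> can be computed from \<open>[i,j]\<close> for any \<open>j \<noteq> i\<close>; we take \<open>j = i + 1\<close>.\<close>

definition flag :: "nat \<Rightarrow> 4 \<Rightarrow> nat \<Rightarrow> 'v set" where
  "flag d i n = span (\<Union>m\<le>n. decomp d i (i + 1) m)"

text \<open>The basis \<open>[i,j,k,l]\<close>, padded by \<open>0\<close> beyond index \<open>d\<close> so that it is a unique function.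
  As usual it does not depend on \<open>i\<close>, which is determined by \<open>j,k,l\<close>.\<close>

definition std_basis :: "nat \<Rightarrow> (4 \<Rightarrow> 'v) \<Rightarrow> 4 \<Rightarrow> 4 \<Rightarrow> 4 \<Rightarrow> 4 \<Rightarrow> nat \<Rightarrow> 'v" where
  "std_basis d \<eta> i j k l =
     (THE u. indexed_basis d u \<and> (\<forall>n\<le>d. u n \<in> decomp d k l n) \<and>
             \<eta> j = (\<Sum>n\<le>d. u n) \<and> (\<forall>n>d. u n = 0))"

definition exchanger :: "('v \<Rightarrow> 'v) \<Rightarrow> bool" where
  "exchanger X \<longleftrightarrow> Vector_Spaces.linear scale scale X \<and> bij X \<and>
     (\<forall>i j. standard i j \<longrightarrow> X \<circ> x i j \<circ> inv_into UNIV X = x (i + 2) (j + 2))"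

end

locale evaluation_module = qtet_module scale q x
  for scale :: "'f::field \<Rightarrow> 'v::ab_group_add \<Rightarrow> 'v" (infixr "*s" 75)
    and q :: 'f and x :: "4 \<Rightarrow> 4 \<Rightarrow> 'v \<Rightarrow> 'v" +
  fixes d :: nat
  assumes finite_dimensional: "finite_dimensional"
    and irreducible: "irreducible_module"
    and nontrivial: "\<not> trivial_module"
    and diameter_type_1: "diameter_type d 1"
    and shape: "has_shape d (\<lambda>_. 1)"
begin

text \<open>\<open>evaluation_parameter t\<close> says that the module is isomorphic to \<open>\<^bold>V\<^sub>d(t)\<close>, that is, it has a
  basis with respect to which the standard generators are represented by the matrices that
  define \<open>\<^bold>V\<^sub>d(t)\<close>. The inverses of matrices exist, so \<open>the\<close> is harmless.\<close>

definition evaluation_parameter :: "'f \<Rightarrow> bool" where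
  "evaluation_parameter t \<longleftrightarrow>
     t \<noteq> 0 \<and> t \<notin> {q powi (int d - 2 * int n + 1) | n. 1 \<le> n \<and> n \<le> d} \<and>
     (\<exists>v.
       represents d (Z_mat d * S_mat d (inverse q) (inverse t) * Z_mat d) v (x 0 1) \<and>
       represents d (E_mat d q) v (x 1 2) \<and>
       represents d (K_mat d q) v (x 2 3) \<and>
       represents d (Z_mat d * G_mat d (inverse q) t * Z_mat d) v (x 3 0) \<and>
       represents d (L_mat d q t) v (x 0 2) \<and>
       represents d (the (mat_inverse (Z_mat d * E_mat d (inverse q) * Z_mat d))) v (x 1 3) \<and>
       represents d (the (mat_inverse (L_mat d q t))) v (x 2 0) \<and>
       represents d (Z_mat d * E_mat d (inverse q) * Z_mat d) v (x 3 1))"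

end

end

theory Submission
  imports Defs
begin

text \<open>
  Fix \<open>k\<close> modulo 4 and consider the mutually inverse generators \<open>A = x k (k+2)\<close> and
  \<open>A' = x (k+2) k\<close>. Each of the four generators \<open>x i (i+1)\<close> forms a q-Weyl pair with \<open>A\<close> or with
  \<open>A'\<close>, so on an eigenbasis of \<open>A\<close> it is bidiagonal with a known diagonal
  (\<open>q_weyl_bidiagonal\<close>). The flag vectors \<open>\<eta> (k+1)\<close> and \<open>\<eta> (k+3)\<close> are common eigenvectors of two of
  these generators each, for extreme eigenvalues; hence they have no zero coordinate
  (\<open>q_weyl_full_support\<close>). Scale the eigenbasis to vectors \<open>u n\<close> with sum \<open>\<eta> (k+1)\<close> and write
  \<open>\<eta> (k+3) = (\<Sum>n\<le>d. c n *s u n)\<close>. The remaining q-Weyl relation between two generators that both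
  lower the index forces \<open>c\<close> to be a geometric progression, say with ratio \<open>r\<close>
  (\<open>c_log_linear\<close>, \<open>c_geometric\<close>).

  Then the map \<open>X\<close> with \<open>X (u n) = (s * r ^ (d - n)) *s u (d - n)\<close> exchanges \<open>A\<close> with \<open>A'\<close> and, up to
  scalars, \<open>\<eta> (k+1)\<close> with \<open>\<eta> (k+3)\<close>. Since a q-Weyl partner of \<open>A\<close> is determined by its value on
  a single vector of full support, these two facts imply that \<open>X\<close> conjugates every \<open>x i (i+1)\<close> to
  \<open>x (i+2) (i+3)\<close> (\<open>q_weyl_intertwine\<close>). In this way each of \<open>k = 1\<close> and \<open>k = 0\<close> produces a map that
  handles all generators except the pair with difference 2 that belongs to the other value of \<open>k\<close>.

  The two maps agree up to a scalar: both conjugate \<open>x 2 3\<close> to \<open>x 0 1\<close>, so on each eigenvector of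
  \<open>x 2 3\<close> their values lie in one eigenspace of \<open>x 0 1\<close>, and \<open>\<eta> 1\<close>, whose coordinates in this
  eigenbasis are all equal and nonzero, is sent by both to a multiple of \<open>\<eta> 3\<close> (\<open>X_eq\<close>). The common
  map is therefore an exchanger, and it is antidiagonal in all eight bases by construction.

  The explicit entries come from the basis that defines \<open>\<^bold>V\<^sub>d(t)\<close>. Four of the
  matrices there give the ratio \<open>t * q ^ (d - 1)\<close> for \<open>k = 1\<close> (\<open>odd_c_1\<close>), the ratio
  \<open>inverse t * q ^ (d - 1)\<close> for \<open>k = 0\<close> (\<open>even_c_1\<close>), and the scalar \<open>(- 1) ^ d * t ^ d\<close> between the two
  maps (\<open>X_eta_1\<close>); the sign of the latter is that of a product of differences of powers of \<open>q\<close>.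
\<close>

section \<open>Powers of a scalar that is not a root of unity\<close>

definition not_root_of_unity :: "'f::field \<Rightarrow> bool" where
  "not_root_of_unity q \<longleftrightarrow> q \<noteq> 0 \<and> (\<forall>n>0. q ^ n \<noteq> 1)"

lemma not_root_of_unityD [simp]: "not_root_of_unity q \<Longrightarrow> q \<noteq> 0"
  by (simp add: not_root_of_unity_def)

lemma not_root_of_unity_inverse [simp]:
  "not_root_of_unity (inverse q) \<longleftrightarrow> not_root_of_unity q"
  by (simp add: not_root_of_unity_def power_inverse)

lemma powi_eq_iff:
  assumes "not_root_of_unity q"
  shows "q powi a = q powi b \<longleftrightarrow> a = b"
proof -
  have key: "a = b" if "q powi a = q powi b" "a \<le> b" for a b
  proof (rule ccontr)
    assume "a \<noteq> b"
    have "q powi (b - a) = 1"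
      using that assms by (simp add: power_int_diff)
    then have "q ^ nat (b - a) = 1"
      using \<open>a \<le> b\<close> by (simp add: power_int_def)
    moreover have "nat (b - a) > 0"
      using \<open>a \<le> b\<close> \<open>a \<noteq> b\<close> by simp
    ultimately show False
      using assms by (auto simp: not_root_of_unity_def)
  qed
  show ?thesis
    using key[of a b] key[of b a] by (cases "a \<le> b") auto
qed

lemma powi_nat_diff: "q \<noteq> 0 \<Longrightarrow> q powi (int a - int b) = q ^ a / (q ^ b :: 'f::field)"
  by (simp add: power_int_diff)

lemma powi_inverse: "inverse q powi k = (q :: 'f::field) powi (- k)"
  by (simp add: power_int_inverse power_int_minus)

lemma q_diff_nonzero: "not_root_of_unity q \<Longrightarrow> q - inverse q \<noteq> 0"
  using powi_eq_iff[of q 1 "- 1"] by (simp add: power_int_minus)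

lemma prod_even_powers: "(\<Prod>i<d. q ^ (2 * i)) = (q :: 'f::field) ^ (d * (d - 1))"
proof (induction d)
  case (Suc d)
  have "d * (d - 1) + 2 * d = Suc d * (Suc d - 1)"
    by (cases d) simp_all
  then show ?case
    using Suc.IH by (simp only: prod.lessThan_Suc flip: power_add)
qed simp

text \<open>Each factor is \<open>- (q ^ (2 * i)) * (1 - q ^ (2 * (d - i)))\<close>; reversing the order of the last factors
  gives the sign that appears in half of the rows of the final table.\<close>

lemma prod_q_differences:
  "(\<Prod>i<d. q ^ (2 * d) - q ^ (2 * i)) =
     (- 1) ^ d * q ^ (d * (d - 1)) * (\<Prod>i<d. 1 - (q :: 'f::field) ^ (2 * Suc i))"
proof -
  have "(\<Prod>i<d. q ^ (2 * d) - q ^ (2 * i)) =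
      (\<Prod>i<d. - 1 * q ^ (2 * i) * (1 - q ^ (2 * Suc (d - Suc i))))"
  proof (intro prod.cong refl)
    fix i assume "i \<in> {..<d}"
    then have "2 * i + 2 * Suc (d - Suc i) = 2 * d" by auto
    then have "q ^ (2 * i) * q ^ (2 * Suc (d - Suc i)) = q ^ (2 * d)"
      by (metis power_add)
    then show "q ^ (2 * d) - q ^ (2 * i) =
        - 1 * q ^ (2 * i) * (1 - q ^ (2 * Suc (d - Suc i)))"
      by (simp add: right_diff_distrib)
  qed
  also have "\<dots> = (- 1) ^ d * (\<Prod>i<d. q ^ (2 * i)) * (\<Prod>i<d. 1 - q ^ (2 * Suc (d - Suc i)))"
    by (simp only: prod.distrib prod_constant card_lessThan)
  also have "(\<Prod>i<d. 1 - q ^ (2 * Suc (d - Suc i))) = (\<Prod>i<d. 1 - q ^ (2 * Suc i))"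
    by (rule prod.nat_diff_reindex[of "\<lambda>i. 1 - q ^ (2 * Suc i)"])
  finally show ?thesis by (simp only: prod_even_powers)
qed

lemma twice_choose_two: "2 * int (d choose 2) = int d * (int d - 1)"
proof -
  have "2 * (d choose 2) = d * (d - 1)"
    unfolding choose_two by (cases d) (auto intro: dvd_mult_div_cancel)
  then have "2 * int (d choose 2) = int (d * (d - 1))"
    by (metis of_nat_mult of_nat_numeral)
  then show ?thesis by (cases d) (simp_all add: algebra_simps)
qed

section \<open>Eigenbases, coordinates and bidiagonal operators\<close>

context vspace
begin

sublocale endo: vector_space_pair scale scale ..

text \<open>Eigenvectors for distinct eigenvalues are independent, in a form that allows some of them to be zero.
  Most identities between operators below are obtained by applying it to the images of a basis.\<close>

lemma eigenvectors_sum_zero: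
  assumes "finite S" and "Vector_Spaces.linear scale scale A" and "inj_on lam S"
    and "\<And>n. n \<in> S \<Longrightarrow> A (w n) = lam n *s w n" and "(\<Sum>n\<in>S. w n) = 0"
  shows "\<forall>n\<in>S. w n = 0"
  using assms(1,3-)
proof (induction S arbitrary: w rule: finite_induct)
  case empty
  then show ?case by simp
next
  case (insert m S)
  have "(\<Sum>n\<in>S. (lam n - lam m) *s w n) = (\<Sum>n\<in>insert m S. (lam n - lam m) *s w n)"
    using insert.hyps by simp
  also have "\<dots> = (\<Sum>n\<in>insert m S. A (w n)) - lam m *s (\<Sum>n\<in>insert m S. w n)"
    using insert.prems(2)
    by (simp only: scale_left_diff_distrib sum_subtractf scale_sum_right cong: sum.cong)
  also have "(\<Sum>n\<in>insert m S. A (w n)) = A (\<Sum>n\<in>insert m S. w n)"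
    by (rule endo.linear_sum[OF assms(2), symmetric])
  also have "A (\<Sum>n\<in>insert m S. w n) - lam m *s (\<Sum>n\<in>insert m S. w n) = 0"
    using insert.prems(3) endo.linear_0[OF assms(2)] by simp
  finally have "\<forall>n\<in>S. (lam n - lam m) *s w n = 0"
  proof (intro insert.IH)
    show "inj_on lam S" using insert.prems(1) by (rule inj_on_subset) auto
    show "A ((lam n - lam m) *s w n) = lam n *s ((lam n - lam m) *s w n)" if "n \<in> S" for n
      using that insert.prems(2)[of n]
      by (simp add: endo.linear_scale[OF assms(2)] mult.commute)
  qed
  moreover have "lam n \<noteq> lam m" if "n \<in> S" for n
    using that insert.prems(1) insert.hyps by (auto simp: inj_on_def)
  ultimately have "\<forall>n\<in>S. w n = 0" by auto
  with insert.prems(3) insert.hyps show ?case by simp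
qed

lemma indexed_basis_expansion:
  assumes "indexed_basis d u"
  obtains a where "w = (\<Sum>n\<le>d. a n *s u n)"
proof -
  have "w \<in> span (u ` {..d})" using assms by (simp add: indexed_basis_def)
  then obtain b where "w = (\<Sum>v\<in>u ` {..d}. b v *s v)"
    by (auto simp: span_finite)
  also have "\<dots> = (\<Sum>n\<le>d. b (u n) *s u n)"
    using assms by (subst sum.reindex) (auto simp: indexed_basis_def)
  finally show thesis by (rule that)
qed

lemma indexed_basis_sum_zero:
  assumes "indexed_basis d u" and "(\<Sum>n\<le>d. a n *s u n) = 0" and "m \<le> d"
  shows "a m = 0"
proof -
  have inj: "inj_on u {..d}" and ind: "independent (u ` {..d})"
    using assms by (auto simp: indexed_basis_def)
  have "(\<Sum>v\<in>u ` {..d}. a (the_inv_into {..d} u v) *s v) = (\<Sum>n\<le>d. a n *s u n)"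
    by (subst sum.reindex[OF inj]) (auto intro!: sum.cong simp: the_inv_into_f_f[OF inj])
  then have "a (the_inv_into {..d} u (u m)) = 0"
    using independentD[OF ind, of "u ` {..d}" "\<lambda>v. a (the_inv_into {..d} u v)"] assms(2,3)
    by simp
  then show ?thesis
    using assms(3) the_inv_into_f_f[OF inj, of m] by simp
qed

lemma indexed_basis_nonzero: "indexed_basis d u \<Longrightarrow> n \<le> d \<Longrightarrow> u n \<noteq> 0"
  using dependent_zero by (force simp: indexed_basis_def)

text \<open>The eigenvectors are independent, and comparison with the basis \<open>v\<close> shows that there are enough of them.\<close>

lemma eigenbasis:
  assumes "indexed_basis d v" and A: "Vector_Spaces.linear scale scale A" and "inj_on lam {..d}"
    and e: "\<And>n. n \<le> d \<Longrightarrow> A (e n) = lam n *s e n" and "\<And>n. n \<le> d \<Longrightarrow> e n \<noteq> 0"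
  shows "indexed_basis d e"
proof -
  interpret finite_dimensional_vector_space scale "v ` {..d}"
    using assms(1) by unfold_locales (auto simp: indexed_basis_def)
  have zero: "a n = 0" if "(\<Sum>n\<le>d. a n *s e n) = 0" "n \<le> d" for a n
  proof -
    have "\<forall>n\<in>{..d}. a n *s e n = 0"
      by (rule eigenvectors_sum_zero[OF _ A assms(3)])
        (use that(1) in \<open>simp_all add: endo.linear_scale[OF A] e mult.commute\<close>)
    then show ?thesis using that(2) assms(5) by auto
  qed
  have inj: "inj_on e {..d}"
  proof (rule inj_onI)
    fix m n assume mn: "m \<in> {..d}" "n \<in> {..d}" "e m = e n"
    have "lam m *s e m = A (e m)" using e[of m] mn(1) by simp
    also have "\<dots> = A (e n)" by (simp only: mn(3))
    also have "\<dots> = lam n *s e m" using e[of n] mn by simp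
    finally show "m = n" using mn assms(3,5) by (auto simp: inj_on_def)
  qed
  have ind: "independent (e ` {..d})"
  proof (rule independent_if_scalars_zero)
    fix f w
    assume sum0: "(\<Sum>w\<in>e ` {..d}. f w *s w) = 0" and "w \<in> e ` {..d}"
    then obtain n where "n \<le> d" "w = e n" by auto
    then show "f w = 0"
      using zero[of "\<lambda>n. f (e n)" n] sum0 by (simp add: sum.reindex[OF inj])
  qed simp
  have "card (e ` {..d}) = card (v ` {..d})"
    using assms(1) inj by (simp add: card_image indexed_basis_def)
  also have "\<dots> = dim UNIV"
    using assms(1) by (intro dim_eq_card[symmetric]) (auto simp: indexed_basis_def)
  finally have "span (e ` {..d}) = UNIV"
    using card_ge_dim_independent[OF subset_UNIV ind] by auto
  then show ?thesis using inj ind by (simp add: indexed_basis_def)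
qed

lemma linear_eq_on_indexed_basis:
  assumes "indexed_basis d u" and "Vector_Spaces.linear scale scale f"
    and "Vector_Spaces.linear scale scale g" and "\<And>n. n \<le> d \<Longrightarrow> f (u n) = g (u n)"
  shows "f = g"
proof
  fix w
  show "f w = g w"
    by (rule endo.linear_eq_on[OF assms(2,3), of _ "u ` {..d}"])
      (use assms(1,4) in \<open>auto simp: indexed_basis_def\<close>)
qed

lemma linear_extension:
  assumes "indexed_basis d u"
  obtains f where "Vector_Spaces.linear scale scale f" and "\<And>n. n \<le> d \<Longrightarrow> f (u n) = w n"
proof -
  have inj: "inj_on u {..d}" and ind: "independent (u ` {..d})"
    using assms by (auto simp: indexed_basis_def)
  obtain f where f: "Vector_Spaces.linear scale scale f"
    "\<forall>x\<in>u ` {..d}. f x = w (the_inv_into {..d} u x)"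
    using endo.linear_independent_extend[OF ind, of "\<lambda>x. w (the_inv_into {..d} u x)"]
    by blast
  show thesis
    using f by (intro that[of f]) (auto simp: the_inv_into_f_f[OF inj])
qed

text \<open>\<open>coord d u w n\<close> is the \<open>n\<close>-th coordinate of \<open>w\<close> in the basis \<open>u\<close>; for \<open>n > d\<close> it has no
  meaning.\<close>

definition coord :: "nat \<Rightarrow> (nat \<Rightarrow> 'v) \<Rightarrow> 'v \<Rightarrow> nat \<Rightarrow> 'f" where
  "coord d u w n = representation (u ` {..d}) w (u n)"

lemma coord_add: "indexed_basis d u \<Longrightarrow> coord d u (v + w) n = coord d u v n + coord d u w n"
  by (simp add: coord_def indexed_basis_def representation_add)

lemma coord_diff: "indexed_basis d u \<Longrightarrow> coord d u (v - w) n = coord d u v n - coord d u w n"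
  by (simp add: coord_def indexed_basis_def representation_diff)

lemma coord_scale: "indexed_basis d u \<Longrightarrow> coord d u (a *s w) n = a * coord d u w n"
  by (simp add: coord_def indexed_basis_def representation_scale)

lemma coord_sum:
  "indexed_basis d u \<Longrightarrow> coord d u (\<Sum>i\<in>I. f i) n = (\<Sum>i\<in>I. coord d u (f i) n)"
  by (simp add: coord_def indexed_basis_def representation_sum)

lemma coord_basis:
  assumes "indexed_basis d u" and "m \<le> d" and "n \<le> d"
  shows "coord d u (u m) n = (if m = n then 1 else 0)"
  using assms by (auto simp: coord_def indexed_basis_def representation_basis inj_on_def)

lemma coord_expansion:
  assumes u: "indexed_basis d u" and "n \<le> d"
  shows "coord d u (\<Sum>m\<le>d. a m *s u m) n = a n"
proof -
  have "coord d u (\<Sum>m\<le>d. a m *s u m) n = (\<Sum>m\<le>d. a m * coord d u (u m) n)"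
    using u by (simp add: coord_sum coord_scale)
  also have "\<dots> = (\<Sum>m\<le>d. if m = n then a m else 0)"
    using assms by (intro sum.cong) (auto simp: coord_basis)
  finally have "coord d u (\<Sum>m\<le>d. a m *s u m) n = (\<Sum>m\<le>d. if m = n then a m else 0)" .
  then show ?thesis using assms by simp
qed

lemma sum_coord: "indexed_basis d u \<Longrightarrow> (\<Sum>n\<le>d. coord d u w n *s u n) = w"
  by (rule indexed_basis_expansion[of d u w]) (auto simp: coord_expansion)

lemma coord_eigen:
  assumes u: "indexed_basis d u" and A: "Vector_Spaces.linear scale scale A"
    and "\<And>n. n \<le> d \<Longrightarrow> A (u n) = lam n *s u n" and "n \<le> d"
  shows "coord d u (A w) n = lam n * coord d u w n"
proof -
  obtain a where w: "w = (\<Sum>n\<le>d. a n *s u n)"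
    using u by (rule indexed_basis_expansion)
  have "A w = (\<Sum>n\<le>d. (a n * lam n) *s u n)"
    using assms by (simp add: w endo.linear_sum[OF A] endo.linear_scale[OF A])
  then show ?thesis
    using assms by (simp add: w coord_expansion)
qed

lemma indexed_basis_reverse:
  assumes "indexed_basis d u"
  shows "indexed_basis d (\<lambda>n. u (d - n))"
proof -
  have "(\<lambda>n. d - n) ` {..d} = {..d}"
  proof -
    have "x \<in> (\<lambda>n. d - n) ` {..d}" if "x \<le> d" for x
      using that by (intro image_eqI[of _ _ "d - x"]) auto
    then show ?thesis by auto
  qed
  then have "u ` (\<lambda>n. d - n) ` {..d} = u ` {..d}" by simp
  then have "(\<lambda>n. u (d - n)) ` {..d} = u ` {..d}"
    by (simp only: image_image)
  moreover have "inj_on (\<lambda>n. u (d - n)) {..d}"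
  proof (rule inj_onI)
    fix m n assume mn: "m \<in> {..d}" "n \<in> {..d}" "u (d - m) = u (d - n)"
    have "d - m = d - n"
      by (rule inj_onD[of u "{..d}"]) (use mn assms in \<open>auto simp: indexed_basis_def\<close>)
    then show "m = n" using mn by simp
  qed
  ultimately show ?thesis
    using assms by (simp add: indexed_basis_def)
qed

lemma represents_antidiag:
  assumes "indexed_basis d w" and "\<And>n. n \<le> d \<Longrightarrow> X (w n) = f (d - n) *s w (d - n)"
  shows "represents d (antidiag_mat d f) w X"
  unfolding represents_def
proof (intro conjI allI impI)
  fix n assume n: "n \<le> d"
  have "(\<Sum>i\<le>d. antidiag_mat d f $$ (i, n) *s w i) =
      (\<Sum>i\<le>d. if i = d - n then f i *s w i else 0)"
    using n by (intro sum.cong) (auto simp: antidiag_mat_def)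
  then show "X (w n) = (\<Sum>i\<le>d. antidiag_mat d f $$ (i, n) *s w i)"
    using n by (simp add: assms(2))
next
  show "antidiag_mat d f \<in> carrier_mat (d + 1) (d + 1)"
    by (simp add: antidiag_mat_def)
qed (fact assms(1))

lemma sum_reverse: "(\<Sum>n\<le>d. f (d - n)) = (\<Sum>n\<le>(d::nat). (f n :: 'v))"
  by (rule sum.reindex_bij_witness[of _ "\<lambda>n. d - n" "\<lambda>n. d - n"]) auto

text \<open>This is the comparison of the \<open>n\<close>-th coordinates in the eigenvector equation. The hypothesis
  \<open>b 0 = 0\<close> makes the value \<open>0 - 1 = 0\<close> of natural subtraction harmless.\<close>

lemma bidiagonal_eigenvector:
  assumes e: "indexed_basis d e" and P: "Vector_Spaces.linear scale scale P" and "b 0 = 0"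
    and P_e: "\<And>n. n \<le> d \<Longrightarrow> P (e n) = lam n *s e n + b n *s e (n - 1)"
    and "P (\<Sum>n\<le>d. a n *s e n) = \<mu> *s (\<Sum>n\<le>d. a n *s e n)" and "n < d"
  shows "b (Suc n) * a (Suc n) = (\<mu> - lam n) * a n"
proof -
  have "coord d e (P (\<Sum>m\<le>d. a m *s e m)) n =
      (\<Sum>m\<le>d. a m * (lam m * coord d e (e m) n + b m * coord d e (e (m - 1)) n))"
    using P_e by (simp add: endo.linear_sum[OF P] endo.linear_scale[OF P] coord_sum[OF e]
        coord_scale[OF e] coord_add[OF e])
  also have "\<dots> = (\<Sum>m\<le>d. (if m = n then lam m * a m else 0) + (if m = Suc n then b m * a m else 0))"
  proof (intro sum.cong refl)
    fix m assume "m \<in> {..d}"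
    then show "a m * (lam m * coord d e (e m) n + b m * coord d e (e (m - 1)) n) =
        (if m = n then lam m * a m else 0) + (if m = Suc n then b m * a m else 0)"
      using \<open>b 0 = 0\<close> \<open>n < d\<close> by (cases m) (auto simp: coord_basis[OF e])
  qed
  also have "\<dots> = lam n * a n + b (Suc n) * a (Suc n)"
    using \<open>n < d\<close> by (simp add: sum.distrib)
  finally have "lam n * a n + b (Suc n) * a (Suc n) = \<mu> * a n"
    using assms(5) \<open>n < d\<close> by (simp add: coord_scale[OF e] coord_expansion[OF e])
  then show ?thesis by (simp add: algebra_simps)
qed

lemma represents_diagonal:
  assumes "represents d M v A" and "n \<le> d"
    and "\<And>i. i \<le> d \<Longrightarrow> M $$ (i, n) = (if i = n then a else 0)"
  shows "A (v n) = a *s v n"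
proof -
  have "A (v n) = (\<Sum>i\<le>d. M $$ (i, n) *s v i)"
    using assms(1,2) by (simp add: represents_def)
  also have "\<dots> = (\<Sum>i\<le>d. if i = n then a *s v i else 0)"
    using assms(3) by (intro sum.cong) auto
  finally show ?thesis using \<open>n \<le> d\<close> by simp
qed

lemma represents_lower_bidiagonal:
  assumes "represents d M v A" and "n \<le> d"
    and "\<And>i. i \<le> d \<Longrightarrow> M $$ (i, n) = (if i = n then a else if i = Suc n then b else 0)"
  shows "A (v n) = a *s v n + (if n < d then b *s v (Suc n) else 0)"
proof -
  have "A (v n) = (\<Sum>i\<le>d. M $$ (i, n) *s v i)"
    using assms(1,2) by (simp add: represents_def)
  also have "\<dots> = (\<Sum>i\<le>d. (if i = n then a *s v i else 0) + (if i = Suc n then b *s v i else 0))"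
    using assms(3) by (intro sum.cong) auto
  finally show ?thesis using \<open>n \<le> d\<close> by (simp add: sum.distrib)
qed

lemma represents_upper_bidiagonal:
  assumes "represents d M v A" and "n \<le> d"
    and "\<And>i. i \<le> d \<Longrightarrow> M $$ (i, n) = (if i = n then a else if n = Suc i then b else 0)"
  shows "A (v n) = a *s v n + (if n = 0 then 0 else b *s v (n - 1))"
proof -
  have "A (v n) = (\<Sum>i\<le>d. M $$ (i, n) *s v i)"
    using assms(1,2) by (simp add: represents_def)
  also have "\<dots> = (\<Sum>i\<le>d. (if i = n then a *s v i else 0) +
      (if i = n - 1 \<and> n \<noteq> 0 then b *s v i else 0))"
    using assms(3) by (intro sum.cong) auto
  finally show ?thesis using \<open>n \<le> d\<close> by (cases "n = 0") (auto simp: sum.distrib)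
qed

lemma lower_bidiagonal_eigenvector:
  assumes e: "indexed_basis d e" and P: "Vector_Spaces.linear scale scale P"
    and P_e: "\<And>n. n \<le> d \<Longrightarrow>
      P (e n) = lam n *s e n + (if n < d then b n *s e (Suc n) else 0)"
    and w: "P w = \<mu> *s w" and "n < d"
  shows "b n * coord d e w n = (\<mu> - lam (Suc n)) * coord d e w (Suc n)"
proof -
  have coord0: "coord d e 0 k = 0" for k
    using coord_scale[OF e, of 0] by simp
  have "coord d e (P w) (Suc n) = coord d e (P (\<Sum>m\<le>d. coord d e w m *s e m)) (Suc n)"
    by (simp only: sum_coord[OF e])
  also have "\<dots> = (\<Sum>m\<le>d. coord d e w m * (lam m * coord d e (e m) (Suc n) +
        (if m < d then b m * coord d e (e (Suc m)) (Suc n) else 0)))"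
    by (auto simp: P_e endo.linear_sum[OF P] endo.linear_scale[OF P] coord_sum[OF e] coord0
        coord_scale[OF e] coord_add[OF e] intro!: sum.cong)
  also have "\<dots> = (\<Sum>m\<le>d. (if m = Suc n then lam m * coord d e w m else 0) +
        (if m = n then b m * coord d e w m else 0))"
    using \<open>n < d\<close> by (intro sum.cong) (auto simp: coord_basis[OF e])
  also have "\<dots> = lam (Suc n) * coord d e w (Suc n) + b n * coord d e w n"
    using \<open>n < d\<close> by (simp add: sum.distrib)
  finally show ?thesis
    by (simp add: w coord_scale[OF e] algebra_simps)
qed

lemma eigenvector_multiple:
  assumes e: "indexed_basis d e" and A: "Vector_Spaces.linear scale scale A"
    and A_e: "\<And>n. n \<le> d \<Longrightarrow> A (e n) = lam n *s e n" and "inj_on lam {..d}"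
    and "m \<le> d" and w: "A w = lam m *s w"
  shows "w = coord d e w m *s e m"
proof -
  have zero: "coord d e w n = 0" if "n \<le> d" "n \<noteq> m" for n
  proof -
    have "lam m * coord d e w n = lam n * coord d e w n"
      using coord_eigen[OF e A A_e \<open>n \<le> d\<close>, of w] by (simp add: w coord_scale[OF e])
    moreover have "lam m \<noteq> lam n"
      using assms(4) that \<open>m \<le> d\<close> by (auto simp: inj_on_def)
    ultimately show ?thesis by auto
  qed
  have "w = (\<Sum>n\<le>d. coord d e w n *s e n)"
    by (rule sum_coord[OF e, symmetric])
  also have "\<dots> = (\<Sum>n\<le>d. if n = m then coord d e w n *s e n else 0)"
    using zero by (intro sum.cong) auto
  finally show ?thesis using \<open>m \<le> d\<close> by simp
qed

text \<open>Taking the coordinate at an eigenvector of \<open>A\<close> is a left eigenvector of \<open>A\<close>. Applied to consecutive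
  vectors \<open>v\<close> and \<open>v'\<close> of a basis on which \<open>A\<close> is bidiagonal, it yields a recursion for the transition
  matrix to an eigenbasis without any inversion.\<close>

lemma coord_bidiagonal:
  assumes u: "indexed_basis d u" and A: "Vector_Spaces.linear scale scale A"
    and A_u: "\<And>n. n \<le> d \<Longrightarrow> A (u n) = lam n *s u n"
    and "A v = a *s v + b *s v'" and "n \<le> d"
  shows "(lam n - a) * coord d u v n = b * coord d u v' n"
  using coord_eigen[OF u A A_u \<open>n \<le> d\<close>, of v] assms(4)
  by (simp add: coord_add[OF u] coord_scale[OF u] algebra_simps)

end

section \<open>The q-Weyl relation\<close>

context vspace
begin

definition q_weyl :: "'f \<Rightarrow> ('v \<Rightarrow> 'v) \<Rightarrow> ('v \<Rightarrow> 'v) \<Rightarrow> bool" where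
  "q_weyl p P Q \<longleftrightarrow>
     (\<forall>v. p *s P (Q v) - inverse p *s Q (P v) = (p - inverse p) *s v)"

text \<open>By this symmetry lowering and raising operators, and the roles of \<open>q\<close> and its inverse, need no
  separate treatment.\<close>

lemma q_weyl_swap:
  assumes "q_weyl p P Q"
  shows "q_weyl (inverse p) Q P"
  unfolding q_weyl_def
proof
  fix v
  have "inverse p *s Q (P v) - p *s P (Q v) = - ((p - inverse p) *s v)"
    using assms by (simp flip: minus_diff_eq[of "p *s P (Q v)"] add: q_weyl_def)
  then show "inverse p *s Q (P v) - inverse (inverse p) *s P (Q v) =
      (inverse p - inverse (inverse p)) *s v"
    by (simp flip: scale_minus_left)
qed

text \<open>Subtracting from \<open>P v\<close> the value that \<open>P\<close> would have if it acted as the inverse of \<open>Q\<close> leaves an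
  eigenvector for the shifted eigenvalue \<open>p\<^sup>2 * l\<close>. Everything about q-Weyl pairs rests on this.\<close>

lemma q_weyl_shift:
  assumes "q_weyl p P Q" and "p \<noteq> 0" and P: "Vector_Spaces.linear scale scale P"
    and Q: "Vector_Spaces.linear scale scale Q" and "Q v = l *s v" and "l \<noteq> 0"
  shows "Q (P v - inverse l *s v) = (p\<^sup>2 * l) *s (P v - inverse l *s v)"
proof -
  have "p *s P (Q v) - inverse p *s Q (P v) = (p - inverse p) *s v"
    using assms(1) by (simp add: q_weyl_def)
  then have "inverse p *s Q (P v) = (p * l) *s P v - (p - inverse p) *s v"
    using assms(5) endo.linear_scale[OF P] by (simp add: algebra_simps)
  then have "p *s (inverse p *s Q (P v)) = p *s ((p * l) *s P v - (p - inverse p) *s v)"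
    by simp
  then have "Q (P v) = (p\<^sup>2 * l) *s P v - (p\<^sup>2 - 1) *s v"
    using assms(2) by (simp add: scale_right_diff_distrib power2_eq_square algebra_simps)
  then have "Q (P v - inverse l *s v) = (p\<^sup>2 * l) *s P v - (p\<^sup>2 - 1) *s v - v"
    using assms(5,6) by (simp add: endo.linear_diff[OF Q] endo.linear_scale[OF Q])
  also have "\<dots> = (p\<^sup>2 * l) *s (P v - inverse l *s v)"
    using assms(6) by (simp add: scale_right_diff_distrib scale_left_diff_distrib)
  finally show ?thesis .
qed

text \<open>The shifted eigenvalue \<open>p\<^sup>2 * p powi (d - 2 * n)\<close> is the one at index \<open>n - 1\<close>, and it does not occur
  for \<open>n = 0\<close>.\<close>

lemma q_weyl_bidiagonal:
  assumes p: "not_root_of_unity p" and PQ: "q_weyl p P Q"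
    and P: "Vector_Spaces.linear scale scale P" and Q: "Vector_Spaces.linear scale scale Q"
    and e: "indexed_basis d e"
    and Q_e: "\<And>n. n \<le> d \<Longrightarrow> Q (e n) = p powi (int d - 2 * int n) *s e n"
  obtains b where "b 0 = 0"
    and "\<And>n. n \<le> d \<Longrightarrow> P (e n) = p powi (2 * int n - int d) *s e n + b n *s e (n - 1)"
proof -
  have ex: "\<exists>\<beta>. (n = 0 \<longrightarrow> \<beta> = 0) \<and>
      P (e n) = p powi (2 * int n - int d) *s e n + \<beta> *s e (n - 1)" if n: "n \<le> d" for n
  proof -
    define w where "w = P (e n) - p powi (2 * int n - int d) *s e n"
    have "inverse (p powi (int d - 2 * int n)) = p powi (2 * int n - int d)"
      by (simp flip: power_int_minus)
    moreover have "p\<^sup>2 * p powi (int d - 2 * int n) = p powi (int d - 2 * int n + 2)"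
      using p by (simp add: power_int_add)
    ultimately have Qw: "Q w = p powi (int d - 2 * int n + 2) *s w"
      using q_weyl_shift[OF PQ _ P Q Q_e[OF n]] p by (simp add: w_def)
    have zero: "coord d e w m = 0" if "m \<le> d" "Suc m \<noteq> n" for m
    proof -
      have "p powi (int d - 2 * int m) * coord d e w m = coord d e (Q w) m"
        using coord_eigen[OF e Q Q_e \<open>m \<le> d\<close>] by simp
      also have "\<dots> = p powi (int d - 2 * int n + 2) * coord d e w m"
        by (simp add: Qw coord_scale[OF e])
      finally have "coord d e w m = 0 \<or>
          p powi (int d - 2 * int m) = p powi (int d - 2 * int n + 2)"
        by (simp only: mult_cancel_right)
      then show ?thesis
        unfolding powi_eq_iff[OF p] using that(2) by auto
    qed
    have "w = (\<Sum>m\<le>d. coord d e w m *s e m)"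
      using sum_coord[OF e] by simp
    also have "\<dots> = (\<Sum>m\<le>d. if m = n - 1 \<and> n \<noteq> 0 then coord d e w m *s e m else 0)"
      using zero by (intro sum.cong) auto
    also have "\<dots> = (if n = 0 then 0 else coord d e w (n - 1)) *s e (n - 1)"
      using n by (cases "n = 0") auto
    finally show ?thesis
      by (intro exI[of _ "if n = 0 then 0 else coord d e w (n - 1)"])
        (simp add: w_def algebra_simps)
  qed
  then obtain b where "\<forall>n\<le>d. (n = 0 \<longrightarrow> b n = 0) \<and>
      P (e n) = p powi (2 * int n - int d) *s e n + b n *s e (n - 1)"
    by metis
  then show thesis by (intro that[of b]) auto
qed

text \<open>For an eigenvector of the bidiagonal \<open>P\<close> with the eigenvalue \<open>p ^ d\<close> of \<open>P\<close> at the top index, a zero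
  coordinate propagates to all smaller indices, because \<open>p ^ d\<close> differs from the other diagonal
  entries.\<close>

lemma q_weyl_coeff_zero_below:
  assumes p: "not_root_of_unity p" and PQ: "q_weyl p P Q"
    and P: "Vector_Spaces.linear scale scale P" and Q: "Vector_Spaces.linear scale scale Q"
    and e: "indexed_basis d e"
    and Q_e: "\<And>n. n \<le> d \<Longrightarrow> Q (e n) = p powi (int d - 2 * int n) *s e n"
    and eigen: "P (\<Sum>n\<le>d. a n *s e n) = p powi (int d) *s (\<Sum>n\<le>d. a n *s e n)"
    and "a m = 0" and "n \<le> m" and "m \<le> d"
  shows "a n = 0"
proof -
  obtain b where b: "b 0 = 0"
    "\<And>n. n \<le> d \<Longrightarrow> P (e n) = p powi (2 * int n - int d) *s e n + b n *s e (n - 1)"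
    by (rule q_weyl_bidiagonal[OF p PQ P Q e Q_e]) auto
  show ?thesis
    using \<open>n \<le> m\<close>
  proof (induction rule: inc_induct)
    case base
    show ?case by fact
  next
    case (step k)
    then have "k < d" using \<open>m \<le> d\<close> by simp
    then have "(p powi int d - p powi (2 * int k - int d)) * a k = 0"
      using bidiagonal_eigenvector[OF e P b eigen, of k] step.IH by simp
    moreover have "p powi int d \<noteq> p powi (2 * int k - int d)"
      unfolding powi_eq_iff[OF p] using \<open>k < d\<close> by simp
    ultimately show ?case by simp
  qed
qed

text \<open>One operator that lowers the index and one that raises it propagate a zero coordinate in both
  directions.\<close>

lemma q_weyl_full_support:
  assumes p: "not_root_of_unity p" and PQ: "q_weyl p P Q" and PQ': "q_weyl p' P' Q'"
    and P: "Vector_Spaces.linear scale scale P" and Q: "Vector_Spaces.linear scale scale Q"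
    and p': "not_root_of_unity p'"
    and P': "Vector_Spaces.linear scale scale P'" and Q': "Vector_Spaces.linear scale scale Q'"
    and e: "indexed_basis d e"
    and Q_e: "\<And>n. n \<le> d \<Longrightarrow> Q (e n) = p powi (int d - 2 * int n) *s e n"
    and Q'_e: "\<And>n. n \<le> d \<Longrightarrow> Q' (e n) = p' powi (2 * int n - int d) *s e n"
    and \<zeta>: "P \<zeta> = p powi (int d) *s \<zeta>" "P' \<zeta> = p' powi (int d) *s \<zeta>" "\<zeta> \<noteq> 0"
    and "n \<le> d"
  shows "coord d e \<zeta> n \<noteq> 0"
proof
  assume n0: "coord d e \<zeta> n = 0"
  have sum: "(\<Sum>m\<le>d. coord d e \<zeta> m *s e m) = \<zeta>" by (rule sum_coord[OF e])
  then have sum': "(\<Sum>m\<le>d. coord d e \<zeta> (d - m) *s e (d - m)) = \<zeta>"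
    using sum_reverse[of "\<lambda>m. coord d e \<zeta> m *s e m" d] by simp
  have below: "coord d e \<zeta> m = 0" if "m \<le> n" for m
    by (rule q_weyl_coeff_zero_below[OF p PQ P Q e Q_e])
      (use \<zeta> that n0 \<open>n \<le> d\<close> in \<open>auto simp: sum\<close>)
  have "Q' (e (d - m)) = p' powi (int d - 2 * int m) *s e (d - m)" if "m \<le> d" for m
    using Q'_e[of "d - m"] that by (simp add: of_nat_diff algebra_simps)
  then have above: "coord d e \<zeta> (d - m) = 0" if "m \<le> d - n" for m
    by (rule q_weyl_coeff_zero_below[OF p' PQ' P' Q' indexed_basis_reverse[OF e],
          where a = "\<lambda>m. coord d e \<zeta> (d - m)" and m = "d - n"])
      (use \<zeta> that n0 \<open>n \<le> d\<close> in \<open>auto simp: sum'\<close>)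
  have "coord d e \<zeta> m = 0" if "m \<le> d" for m
    using below[of m] above[of "d - m"] that by (cases "m \<le> n") auto
  then have "\<zeta> = 0" using sum by simp
  with \<zeta>(3) show False by simp
qed

text \<open>The differences \<open>P' (X (e n)) - X (P (e n))\<close> are eigenvectors of \<open>Q'\<close> for distinct eigenvalues by
  \<open>q_weyl_shift\<close>. Weighted with the coordinates of \<open>\<zeta>\<close> they add up to zero, so each of them vanishes.\<close>

lemma q_weyl_intertwine:
  assumes p: "p \<noteq> 0" and PQ: "q_weyl p P Q" "q_weyl p P' Q'"
    and P: "Vector_Spaces.linear scale scale P" and Q: "Vector_Spaces.linear scale scale Q"
    and P': "Vector_Spaces.linear scale scale P'" and Q': "Vector_Spaces.linear scale scale Q'"
    and X: "Vector_Spaces.linear scale scale X"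
    and e: "indexed_basis d e" and Q_e: "\<And>n. n \<le> d \<Longrightarrow> Q (e n) = lam n *s e n"
    and lam: "inj_on lam {..d}" "\<And>n. n \<le> d \<Longrightarrow> lam n \<noteq> 0"
    and XQ: "X \<circ> Q = Q' \<circ> X"
    and \<zeta>: "\<zeta> = (\<Sum>n\<le>d. a n *s e n)" "\<And>n. n \<le> d \<Longrightarrow> a n \<noteq> 0"
      "P \<zeta> = \<mu> *s \<zeta>" "P' (X \<zeta>) = \<mu> *s X \<zeta>"
  shows "X \<circ> P = P' \<circ> X"
proof -
  have XQ': "X (Q v) = Q' (X v)" for v using fun_cong[OF XQ, of v] by simp
  define D where "D v = P' (X v) - X (P v)" for v
  have linD: "D (\<Sum>n\<le>d. a n *s e n) = (\<Sum>n\<le>d. a n *s D (e n))"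
    by (simp add: D_def endo.linear_sum[OF X] endo.linear_sum[OF P'] endo.linear_sum[OF P]
        endo.linear_scale[OF X] endo.linear_scale[OF P'] endo.linear_scale[OF P]
        sum_subtractf scale_right_diff_distrib)
  have D_eigen: "Q' (D (e n)) = (p\<^sup>2 * lam n) *s D (e n)" if n: "n \<le> d" for n
  proof -
    have "Q' (X (e n)) = lam n *s X (e n)"
      using Q_e[OF n] XQ'[of "e n"] by (simp add: endo.linear_scale[OF X])
    from q_weyl_shift[OF PQ(2) p P' Q' this lam(2)[OF n]]
    have 1: "Q' (P' (X (e n)) - inverse (lam n) *s X (e n)) =
        (p\<^sup>2 * lam n) *s (P' (X (e n)) - inverse (lam n) *s X (e n))" .
    have 2: "Q' (X (P (e n)) - inverse (lam n) *s X (e n)) =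
        (p\<^sup>2 * lam n) *s (X (P (e n)) - inverse (lam n) *s X (e n))"
      using arg_cong[OF q_weyl_shift[OF PQ(1) p P Q Q_e[OF n] lam(2)[OF n]], of X]
      by (simp add: XQ' endo.linear_diff[OF X] endo.linear_scale[OF X])
    have D_n: "D (e n) = (P' (X (e n)) - inverse (lam n) *s X (e n)) -
        (X (P (e n)) - inverse (lam n) *s X (e n))"
      by (simp add: D_def)
    show ?thesis
      unfolding D_n endo.linear_diff[OF Q', of "_ - _" "_ - _"] 1 2
      by (simp only: scale_right_diff_distrib)
  qed
  have "\<forall>n\<in>{..d}. a n *s D (e n) = 0"
  proof (rule eigenvectors_sum_zero[OF _ Q'])
    show "inj_on (\<lambda>n. p\<^sup>2 * lam n) {..d}"
      using lam(1) p by (auto simp: inj_on_def)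
    show "Q' (a n *s D (e n)) = (p\<^sup>2 * lam n) *s (a n *s D (e n))" if "n \<in> {..d}" for n
      using that by (simp add: D_eigen endo.linear_scale[OF Q'] mult_ac)
    show "(\<Sum>n\<le>d. a n *s D (e n)) = 0"
      unfolding linD[symmetric] \<zeta>(1)[symmetric]
      by (simp add: D_def \<zeta>(3,4) endo.linear_scale[OF X])
  qed simp
  then have "D (e n) = 0" if "n \<le> d" for n
    using that \<zeta>(2) by auto
  then show ?thesis
    by (intro linear_eq_on_indexed_basis[OF e] Vector_Spaces.linear_compose[of _ scale] P P' X)
      (simp add: D_def)
qed

end

section \<open>Antipodal pairs\<close>

text \<open>The operators stand for \<open>A = x k (k+2)\<close>, \<open>A' = x (k+2) k\<close>, \<open>B = x k (k+1)\<close>, \<open>C = x (k+1) (k+2)\<close>,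
  \<open>D = x (k+2) (k+3)\<close> and \<open>F = x (k+3) k\<close>, the vectors \<open>\<eta>\<close> and \<open>\<eta>'\<close> for \<open>\<eta> (k+1)\<close> and
  \<open>\<eta> (k+3)\<close>, and \<open>e\<close> for any eigenbasis of \<open>A\<close>. Keeping them abstract allows one treatment of
  \<open>k = 0\<close> and \<open>k = 1\<close>.\<close>

locale antipodal_pair = vspace scale
  for scale :: "'f::field \<Rightarrow> 'v::ab_group_add \<Rightarrow> 'v" (infixr "*s" 75) +
  fixes q :: 'f and d :: nat
    and A A' B C D F :: "'v \<Rightarrow> 'v" and e :: "nat \<Rightarrow> 'v" and \<eta> \<eta>' :: 'v
  assumes q: "not_root_of_unity q"
    and linear_A: "Vector_Spaces.linear scale scale A"
    and linear_A': "Vector_Spaces.linear scale scale A'"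
    and linear_B: "Vector_Spaces.linear scale scale B"
    and linear_C: "Vector_Spaces.linear scale scale C"
    and linear_D: "Vector_Spaces.linear scale scale D"
    and linear_F: "Vector_Spaces.linear scale scale F"
    and basis_e: "indexed_basis d e"
    and A_e: "\<And>n. n \<le> d \<Longrightarrow> A (e n) = q powi (int d - 2 * int n) *s e n"
    and A'_e: "\<And>n. n \<le> d \<Longrightarrow> A' (e n) = q powi (2 * int n - int d) *s e n"
    and weyl_A'B: "q_weyl q A' B" and weyl_CA': "q_weyl q C A'"
    and weyl_FA: "q_weyl q F A" and weyl_AD: "q_weyl q A D"
    and weyl_FB: "q_weyl q F B"
    and \<eta>: "\<eta> \<noteq> 0" "B \<eta> = q powi (- int d) *s \<eta>" "C \<eta> = q powi int d *s \<eta>"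
    and \<eta>': "\<eta>' \<noteq> 0" "D \<eta>' = q powi (- int d) *s \<eta>'" "F \<eta>' = q powi int d *s \<eta>'"
begin

text \<open>The basis \<open>u\<close> is the basis \<open>[k+3,k+1,k,k+2]\<close>, and \<open>n \<mapsto> c n *s u n\<close> is the basis
  \<open>[k+1,k+3,k,k+2]\<close>.\<close>

definition u :: "nat \<Rightarrow> 'v" where
  "u n = coord d e \<eta> n *s e n"

definition c :: "nat \<Rightarrow> 'f" where
  "c n = coord d e \<eta>' n / coord d e \<eta> n"

lemma q_nonzero [simp]: "q \<noteq> 0"
  using q by simp

lemma inverse_q: "not_root_of_unity (inverse q)"
  using q by simp

lemma weyl_BA': "q_weyl (inverse q) B A'" and weyl_DA: "q_weyl (inverse q) D A"
  using q_weyl_swap weyl_A'B weyl_AD by blast+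

lemma coord_\<eta>_nonzero:
  assumes "n \<le> d"
  shows "coord d e \<eta> n \<noteq> 0"
  by (rule q_weyl_full_support[OF inverse_q weyl_BA' weyl_CA' linear_B linear_A' q
        linear_C linear_A' basis_e])
    (use assms A'_e \<eta> in \<open>simp_all add: powi_inverse del: power_int_of_nat\<close>)

lemma coord_\<eta>'_nonzero:
  assumes "n \<le> d"
  shows "coord d e \<eta>' n \<noteq> 0"
  by (rule q_weyl_full_support[OF q weyl_FA weyl_DA linear_F linear_A inverse_q
        linear_D linear_A basis_e])
    (use assms A_e \<eta>' in \<open>simp_all add: powi_inverse del: power_int_of_nat\<close>)

lemma c_nonzero: "n \<le> d \<Longrightarrow> c n \<noteq> 0"
  by (simp add: c_def coord_\<eta>_nonzero coord_\<eta>'_nonzero)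

lemma A_u: "n \<le> d \<Longrightarrow> A (u n) = q powi (int d - 2 * int n) *s u n"
  by (simp add: u_def endo.linear_scale[OF linear_A] A_e mult.commute)

lemma A'_u: "n \<le> d \<Longrightarrow> A' (u n) = q powi (2 * int n - int d) *s u n"
  by (simp add: u_def endo.linear_scale[OF linear_A'] A'_e mult.commute)

lemma inj_eigenvalues: "inj_on (\<lambda>n. q powi (int d - 2 * int n)) {..d}"
  by (auto simp: inj_on_def powi_eq_iff[OF q])

lemma scaled_basis:
  assumes "\<And>n. n \<le> d \<Longrightarrow> a n \<noteq> 0"
  shows "indexed_basis d (\<lambda>n. a n *s u n)"
proof (rule eigenbasis[OF basis_e linear_A inj_eigenvalues])
  fix n assume n: "n \<le> d"
  show "A (a n *s u n) = q powi (int d - 2 * int n) *s a n *s u n"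
    using n by (simp add: endo.linear_scale[OF linear_A] A_u mult.commute)
  show "a n *s u n \<noteq> 0"
    using n assms coord_\<eta>_nonzero indexed_basis_nonzero[OF basis_e] by (simp add: u_def)
qed

lemma basis_u: "indexed_basis d u"
  using scaled_basis[of "\<lambda>_. 1"] by simp

lemma sum_u: "(\<Sum>n\<le>d. u n) = \<eta>"
  by (simp add: u_def sum_coord[OF basis_e])

lemma sum_cu: "(\<Sum>n\<le>d. c n *s u n) = \<eta>'"
proof -
  have "(\<Sum>n\<le>d. c n *s u n) = (\<Sum>n\<le>d. coord d e \<eta>' n *s e n)"
    by (intro sum.cong) (auto simp: c_def u_def coord_\<eta>_nonzero)
  then show ?thesis by (simp add: sum_coord[OF basis_e])
qed

lemma coord_u_\<eta>: "n \<le> d \<Longrightarrow> coord d u \<eta> n = 1"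
  using coord_expansion[OF basis_u, of n "\<lambda>_. 1"] by (simp add: sum_u)

lemma coord_u_\<eta>': "n \<le> d \<Longrightarrow> coord d u \<eta>' n = c n"
  using coord_expansion[OF basis_u, of n c] by (simp add: sum_cu)

text \<open>Both \<open>B\<close> and \<open>F\<close> lower the index. Their off-diagonal entries are determined by the eigenvectors
  \<open>\<eta>\<close> and \<open>\<eta>'\<close>, and the coefficient of \<open>u n\<close> in the q-Weyl relation between \<open>F\<close> and \<open>B\<close>, applied
  to \<open>u (n + 2)\<close>, compares consecutive entries.\<close>

lemma c_log_linear:
  assumes n: "Suc (Suc n) \<le> d"
  shows "c (Suc (Suc n)) * c n = (c (Suc n))\<^sup>2"
proof -
  obtain b where b: "b 0 = 0"
    "\<And>n. n \<le> d \<Longrightarrow> B (u n) = inverse q powi (2 * int n - int d) *s u n + b n *s u (n - 1)"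
    by (rule q_weyl_bidiagonal[OF inverse_q weyl_BA' linear_B linear_A' basis_u])
      (auto simp: A'_u powi_inverse)
  obtain f where f: "f 0 = 0"
    "\<And>n. n \<le> d \<Longrightarrow> F (u n) = q powi (2 * int n - int d) *s u n + f n *s u (n - 1)"
    by (rule q_weyl_bidiagonal[OF q weyl_FA linear_F linear_A basis_u])
      (auto simp: A_u)
  have b_Suc: "b (Suc k) = q powi (- int d) - q powi (int d - 2 * int k)" if "k < d" for k
    using bidiagonal_eigenvector[OF basis_u linear_B b, of "\<lambda>_. 1" "q powi (- int d)" k]
      \<eta>(2) that by (simp add: sum_u powi_inverse)
  have f_Suc: "f (Suc k) * c (Suc k) = (q powi int d - q powi (2 * int k - int d)) * c k"
    if "k < d" for k
    using bidiagonal_eigenvector[OF basis_u linear_F f, of c "q powi int d" k]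
      \<eta>'(3) that by (simp add: sum_cu)
  have b_nonzero: "b (Suc k) \<noteq> 0" if "k < d" for k
    using that by (auto simp: b_Suc powi_eq_iff[OF q])
  have ratio: "f (Suc k) * c (Suc k) = - (q ^ (2 * k)) * b (Suc k) * c k" if "k < d" for k
  proof -
    have "q powi int d - q powi (2 * int k - int d) =
        - (q powi (2 * int k) * (q powi (- int d) - q powi (int d - 2 * int k)))"
      by (simp add: right_diff_distrib flip: power_int_add)
    also have "q powi (2 * int k) = q ^ (2 * k)"
      using power_int_of_nat[of q "2 * k"] by simp
    finally show ?thesis
      using that by (simp add: f_Suc b_Suc)
  qed
  let ?m = "Suc (Suc n)"
  have "coord d u (q *s F (B (u ?m)) - inverse q *s B (F (u ?m))) n
      = coord d u ((q - inverse q) *s u ?m) n"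
    using weyl_FB by (simp add: q_weyl_def)
  then have "q * (b ?m * f (Suc n)) = inverse q * (f ?m * b (Suc n))"
    using n by (simp add: b(2) f(2) endo.linear_add[OF linear_F] endo.linear_add[OF linear_B]
        endo.linear_scale[OF linear_F] endo.linear_scale[OF linear_B] scale_right_distrib
        coord_add[OF basis_u] coord_scale[OF basis_u] coord_basis[OF basis_u] coord_diff[OF basis_u])
  then have "q\<^sup>2 * b ?m * f (Suc n) = f ?m * b (Suc n)"
    by (simp add: field_simps power2_eq_square)
  then have "q\<^sup>2 * b ?m * (f (Suc n) * c (Suc n)) * c ?m = (f ?m * c ?m) * b (Suc n) * c (Suc n)"
    by (simp add: mult_ac)
  then have "q ^ (2 * Suc n) * b ?m * b (Suc n) * (c n * c ?m) =
      q ^ (2 * Suc n) * b ?m * b (Suc n) * (c (Suc n) * c (Suc n))"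
    using n by (simp add: ratio power2_eq_square mult_ac)
  then show ?thesis
    using b_nonzero[of "Suc n"] b_nonzero[of n] n
    by (simp add: power2_eq_square mult.commute)
qed

text \<open>For \<open>d = 0\<close> there is no \<open>c 1\<close>, and the assertion holds for every \<open>r\<close>; hence the guard.\<close>

lemma c_geometric:
  assumes "1 \<le> d \<Longrightarrow> c 1 = c 0 * r" and "n \<le> d"
  shows "c n = c 0 * r ^ n"
  using \<open>n \<le> d\<close>
proof (induction n rule: less_induct)
  case (less n)
  consider "n = 0" | "n = 1" | m where "n = Suc (Suc m)"
    by (metis One_nat_def not0_implies_Suc)
  then show ?case
  proof cases
    case 3
    then have "c n * c m = (c (Suc m))\<^sup>2"
      using c_log_linear less.prems by simp
    moreover have "c m = c 0 * r ^ m" "c (Suc m) = c 0 * r ^ Suc m"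
      using less.IH[of m] less.IH[of "Suc m"] less.prems 3 by simp_all
    ultimately have "c n * c m = (c 0 * r ^ n) * c m"
      using 3 by (simp add: power2_eq_square mult_ac)
    then show ?thesis
      using c_nonzero[of m] less.prems 3 by simp
  qed (use assms less.prems in auto)
qed

end

section \<open>The exchange map of an antipodal pair\<close>

text \<open>The coordinates \<open>c\<close> of \<open>\<eta>'\<close> form a geometric progression. Its ratio \<open>r\<close> carries the evaluation parameter;
  the scalar \<open>s\<close> is left free in order to match the maps that come from two different pairs.\<close>

locale geometric_antipodal_pair = antipodal_pair scale q d A A' B C D F e \<eta> \<eta>'
  for scale :: "'f::field \<Rightarrow> 'v::ab_group_add \<Rightarrow> 'v" (infixr "*s" 75)
    and q :: 'f and d :: nat
    and A A' B C D F :: "'v \<Rightarrow> 'v" and e :: "nat \<Rightarrow> 'v" and \<eta> \<eta>' :: 'v +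
  fixes r s :: 'f
  assumes c_1: "1 \<le> d \<Longrightarrow> c 1 = c 0 * r" and r: "r \<noteq> 0" and s: "s \<noteq> 0"
begin

lemma c_eq: "n \<le> d \<Longrightarrow> c n = c 0 * r ^ n"
  using c_geometric c_1 .

lemma c_flip: "n \<le> d \<Longrightarrow> c n * r ^ (d - n) = c 0 * r ^ d"
  using c_eq[of n] by (simp add: mult.assoc flip: power_add)

text \<open>The coefficients are chosen proportional to \<open>c\<close> in reverse order, so that \<open>X \<eta>\<close> is a multiple of
  \<open>\<eta>'\<close>. That \<open>X \<eta>'\<close> is a multiple of \<open>\<eta>\<close> then amounts to \<open>c n * c (d - n)\<close> being constant, which
  holds for a geometric progression.\<close>

definition X :: "'v \<Rightarrow> 'v" where
  "X = (SOME X. Vector_Spaces.linear scale scale X \<and>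
     (\<forall>n\<le>d. X (u n) = (s * r ^ (d - n)) *s u (d - n)))"

lemma linear_X: "Vector_Spaces.linear scale scale X"
  and X_u: "n \<le> d \<Longrightarrow> X (u n) = (s * r ^ (d - n)) *s u (d - n)"
proof -
  have "\<exists>X. Vector_Spaces.linear scale scale X \<and>
     (\<forall>n\<le>d. X (u n) = (s * r ^ (d - n)) *s u (d - n))"
    using linear_extension[OF basis_u, of "\<lambda>n. (s * r ^ (d - n)) *s u (d - n)"] by blast
  from someI_ex[OF this]
  show "Vector_Spaces.linear scale scale X"
    and "n \<le> d \<Longrightarrow> X (u n) = (s * r ^ (d - n)) *s u (d - n)"
    by (auto simp: X_def)
qed

lemma X_X: "X (X w) = (s\<^sup>2 * r ^ d) *s w"
proof -
  have "X \<circ> X = (\<lambda>w. (s\<^sup>2 * r ^ d) *s w)"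
  proof (rule linear_eq_on_indexed_basis[OF basis_u])
    show "Vector_Spaces.linear scale scale (X \<circ> X)"
      by (rule Vector_Spaces.linear_compose[OF linear_X linear_X])
    show "Vector_Spaces.linear scale scale (\<lambda>w. (s\<^sup>2 * r ^ d) *s w)"
      by (rule linear_scale_self)
    fix n assume n: "n \<le> d"
    have "r ^ (d - n) * r ^ n = r ^ d"
      using n by (simp flip: power_add)
    then show "(X \<circ> X) (u n) = (s\<^sup>2 * r ^ d) *s u n"
      using n by (simp add: X_u endo.linear_scale[OF linear_X] power2_eq_square mult_ac)
  qed
  from fun_cong[OF this, of w] show ?thesis by simp
qed

lemma bij_X: "bij X"
proof (rule bijI')
  show "X v = X w \<longleftrightarrow> v = w" for v w
  proof
    assume "X v = X w"
    then have "X (X v) = X (X w)" by simp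
    then show "v = w" using r s by (simp add: X_X)
  qed simp
  show "\<exists>v. w = X v" for w
  proof
    have nonzero: "s\<^sup>2 * r ^ d \<noteq> 0" using r s by simp
    show "w = X (inverse (s\<^sup>2 * r ^ d) *s X w)"
      by (simp only: endo.linear_scale[OF linear_X] X_X scale_scale
          left_inverse[OF nonzero] scale_one)
  qed
qed

lemma X_\<eta>: "X \<eta> = (s * inverse (c 0)) *s \<eta>'"
proof -
  have "X \<eta> = X (\<Sum>n\<le>d. u n)"
    by (simp only: sum_u)
  also have "\<dots> = (\<Sum>n\<le>d. (s * r ^ (d - n)) *s u (d - n))"
    by (simp add: X_u endo.linear_sum[OF linear_X])
  also have "\<dots> = (\<Sum>n\<le>d. (s * r ^ n) *s u n)"
    by (rule sum_reverse[of "\<lambda>n. (s * r ^ n) *s u n"])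
  also have "\<dots> = (s * inverse (c 0)) *s (\<Sum>n\<le>d. c n *s u n)"
  proof -
    have "s * r ^ n = s * inverse (c 0) * c n" if "n \<le> d" for n
      using c_nonzero[of 0] c_eq[OF that] by simp
    then show ?thesis
      unfolding scale_sum_right scale_scale by (intro sum.cong refl) (simp only: atMost_iff)
  qed
  finally show ?thesis by (simp only: sum_cu)
qed

lemma X_\<eta>': "X \<eta>' = (s * c 0 * r ^ d) *s \<eta>"
proof -
  have "X \<eta>' = X (\<Sum>n\<le>d. c n *s u n)"
    by (simp only: sum_cu)
  also have "\<dots> = (\<Sum>n\<le>d. (s * (c n * r ^ (d - n))) *s u (d - n))"
    by (simp add: X_u endo.linear_sum[OF linear_X] endo.linear_scale[OF linear_X] mult_ac)
  also have "\<dots> = (\<Sum>n\<le>d. (s * c 0 * r ^ d) *s u (d - n))"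
    by (simp add: c_flip mult.assoc)
  also have "\<dots> = (s * c 0 * r ^ d) *s \<eta>"
    using sum_reverse[of u d] by (simp add: sum_u flip: scale_sum_right)
  finally show ?thesis .
qed

lemma X_A: "X \<circ> A = A' \<circ> X" and X_A': "X \<circ> A' = A \<circ> X"
proof -
  have "(X \<circ> A) (u n) = (A' \<circ> X) (u n)" if "n \<le> d" for n
    using that A'_u[of "d - n"]
    by (simp add: A_u X_u endo.linear_scale[OF linear_X] endo.linear_scale[OF linear_A']
        of_nat_diff algebra_simps)
  then show "X \<circ> A = A' \<circ> X"
    by (intro linear_eq_on_indexed_basis[OF basis_u] Vector_Spaces.linear_compose[of _ scale]
        linear_X linear_A linear_A') auto
  have "(X \<circ> A') (u n) = (A \<circ> X) (u n)" if "n \<le> d" for n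
    using that A_u[of "d - n"]
    by (simp add: A'_u X_u endo.linear_scale[OF linear_X] endo.linear_scale[OF linear_A]
        of_nat_diff algebra_simps)
  then show "X \<circ> A' = A \<circ> X"
    by (intro linear_eq_on_indexed_basis[OF basis_u] Vector_Spaces.linear_compose[of _ scale]
        linear_X linear_A linear_A') auto
qed

lemma inj_eigenvalues': "inj_on (\<lambda>n. q powi (2 * int n - int d)) {..d}"
  by (auto simp: inj_on_def powi_eq_iff[OF q])

text \<open>Each of the four generators is characterized by its q-Weyl relation with \<open>A\<close> or \<open>A'\<close> and its
  eigenvalue on \<open>\<eta>\<close> or \<open>\<eta>'\<close>; \<open>X\<close> transports the characterization of one to that of its opposite.\<close>

lemma X_B: "X \<circ> B = D \<circ> X"
  by (rule q_weyl_intertwine[OF _ weyl_BA' weyl_DA linear_B linear_A' linear_D linear_A linear_X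
        basis_u A'_u inj_eigenvalues' _ X_A', where \<zeta> = \<eta> and \<mu> = "q powi (- int d)" and a = "\<lambda>_. 1"])
    (simp_all add: \<eta> \<eta>' X_\<eta> sum_u endo.linear_scale[OF linear_D] mult.commute)

lemma X_C: "X \<circ> C = F \<circ> X"
  by (rule q_weyl_intertwine[OF _ weyl_CA' weyl_FA linear_C linear_A' linear_F linear_A linear_X
        basis_u A'_u inj_eigenvalues' _ X_A', where \<zeta> = \<eta> and \<mu> = "q powi int d" and a = "\<lambda>_. 1"])
    (simp_all add: \<eta> \<eta>' X_\<eta> sum_u endo.linear_scale[OF linear_F] mult.commute)

lemma X_D: "X \<circ> D = B \<circ> X"
  by (rule q_weyl_intertwine[OF _ weyl_DA weyl_BA' linear_D linear_A linear_B linear_A' linear_X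
        basis_u A_u inj_eigenvalues _ X_A, where \<zeta> = \<eta>' and \<mu> = "q powi (- int d)" and a = c])
    (simp_all add: \<eta> \<eta>' X_\<eta>' sum_cu c_nonzero endo.linear_scale[OF linear_B] mult.commute)

lemma X_F: "X \<circ> F = C \<circ> X"
  by (rule q_weyl_intertwine[OF _ weyl_FA weyl_CA' linear_F linear_A linear_C linear_A' linear_X
        basis_u A_u inj_eigenvalues _ X_A, where \<zeta> = \<eta>' and \<mu> = "q powi int d" and a = c])
    (simp_all add: \<eta> \<eta>' X_\<eta>' sum_cu c_nonzero endo.linear_scale[OF linear_C] mult.commute)

text \<open>The following lemmas give the action of \<open>X\<close> on the bases \<open>u\<close> and \<open>c n *s u n\<close> and on their
  reversals; reversal replaces the decomposition \<open>[k,k+2]\<close> by \<open>[k+2,k]\<close>.\<close>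

lemma X_u_reverse: "n \<le> d \<Longrightarrow> X (u (d - n)) = (s * r ^ n) *s u n"
  using X_u[of "d - n"] by simp

lemma c_balance: "n \<le> d \<Longrightarrow> c n * r ^ (d - n) = c (d - n) * r ^ n"
  using c_flip[of n] c_flip[of "d - n"] by simp

lemma X_cu: "n \<le> d \<Longrightarrow> X (c n *s u n) = (s * r ^ n) *s (c (d - n) *s u (d - n))"
  using c_balance[of n] by (simp add: endo.linear_scale[OF linear_X] X_u mult_ac)

lemma X_cu_reverse:
  assumes "n \<le> d"
  shows "X (c (d - n) *s u (d - n)) = (s * r ^ (d - n)) *s (c n *s u n)"
  using X_cu[of "d - n"] assms by simp

lemma basis_cu: "indexed_basis d (\<lambda>n. c n *s u n)"
  by (rule scaled_basis[OF c_nonzero])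

lemma A'_u_reverse:
  assumes "n \<le> d"
  shows "A' (u (d - n)) = q powi (int d - 2 * int n) *s u (d - n)"
  using A'_u[of "d - n"] assms by (simp add: of_nat_diff algebra_simps)

end

section \<open>Modules for the q-tetrahedron algebra\<close>

lemma four_cases: "(i::4) = 0 \<or> i = 1 \<or> i = 2 \<or> i = 3"
proof (cases i)
  case (of_int z)
  then have "z = 0 \<or> z = 1 \<or> z = 2 \<or> z = 3" by auto
  then show ?thesis using of_int by auto
qed

lemma four_arith [simp]: "(- 1 :: 4) = 3" "(- 2 :: 4) = 2" "(- 3 :: 4) = 1"
  "(4 :: 4) = 0" "(5 :: 4) = 1"
  by (simp_all)

context qtet_module
begin

lemma q_weyl_x:
  assumes "not_root_of_unity q" and "(j - i, k - j) \<in> {(1, 1), (1, 2), (2, 1)}"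
  shows "q_weyl q (x i j) (x j k)"
  unfolding q_weyl_def
proof
  fix v
  have "(q - inverse q) *s inverse (q - inverse q) *s
      (q *s x i j (x j k v) - inverse q *s x j k (x i j v)) = (q - inverse q) *s v"
    using rel_q_Weyl[OF assms(2)] by simp
  then show "q *s x i j (x j k v) - inverse q *s x j k (x i j v) = (q - inverse q) *s v"
    using q_diff_nonzero[OF assms(1)] by simp
qed

text \<open>Two bases with the defining properties differ by eigenvectors for distinct eigenvalues with sum zero.\<close>

lemma std_basis_eqI:
  assumes q: "not_root_of_unity q" and "standard k l" and w: "indexed_basis d w"
    and x_w: "\<And>n. n \<le> d \<Longrightarrow> x k l (w n) = q powi (int d - 2 * int n) *s w n"
    and sum: "(\<Sum>n\<le>d. w n) = \<eta> j"
  shows "std_basis d \<eta> i j k l = (\<lambda>n. if n \<le> d then w n else 0)"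
  unfolding std_basis_def
proof (rule the_equality)
  let ?w = "\<lambda>n. if n \<le> d then w n else 0"
  have "?w ` {..d} = w ` {..d}" "inj_on ?w {..d} = inj_on w {..d}"
    by (auto simp: inj_on_def)
  then have "indexed_basis d ?w"
    using w by (simp add: indexed_basis_def)
  then show "indexed_basis d ?w \<and> (\<forall>n\<le>d. ?w n \<in> decomp d k l n) \<and>
      \<eta> j = (\<Sum>n\<le>d. ?w n) \<and> (\<forall>n>d. ?w n = 0)"
    using \<open>standard k l\<close> x_w sum by (simp add: decomp_def eigenspace_def)
next
  fix u
  assume u: "indexed_basis d u \<and> (\<forall>n\<le>d. u n \<in> decomp d k l n) \<and>
      \<eta> j = (\<Sum>n\<le>d. u n) \<and> (\<forall>n>d. u n = 0)"
  have lin: "Vector_Spaces.linear scale scale (x k l)"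
    using \<open>standard k l\<close> by (rule linear_x)
  have "\<forall>n\<in>{..d}. u n - w n = 0"
  proof (rule eigenvectors_sum_zero[OF _ lin])
    show "inj_on (\<lambda>n. q powi (int d - 2 * int n)) {..d}"
      by (auto simp: inj_on_def powi_eq_iff[OF q])
    show "(\<Sum>n\<le>d. u n - w n) = 0"
      using u sum by (simp add: sum_subtractf)
    show "x k l (u n - w n) = q powi (int d - 2 * int n) *s (u n - w n)" if "n \<in> {..d}" for n
      using that u \<open>standard k l\<close> x_w[of n]
      by (simp add: decomp_def eigenspace_def endo.linear_diff[OF lin] scale_right_diff_distrib)
  qed simp
  then show "u = (\<lambda>n. if n \<le> d then w n else 0)"
    using u by auto
qed

lemma represents_std_basis:
  assumes "not_root_of_unity q" and "standard k l" and w: "indexed_basis d w"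
    and "\<And>n. n \<le> d \<Longrightarrow> x k l (w n) = q powi (int d - 2 * int n) *s w n"
    and "(\<Sum>n\<le>d. w n) = \<eta> j"
    and X: "\<And>n. n \<le> d \<Longrightarrow> X (w n) = f (d - n) *s w (d - n)"
  shows "represents d (antidiag_mat d f) (std_basis d \<eta> i j k l) X"
proof -
  have eq: "std_basis d \<eta> i j k l = (\<lambda>n. if n \<le> d then w n else 0)"
    by (rule std_basis_eqI) fact+
  have "represents d (antidiag_mat d f) w X"
    by (rule represents_antidiag[where f = f, OF w X])
  then show ?thesis
    unfolding eq represents_def indexed_basis_def
    by (simp add: inj_on_def cong: image_cong_simp)
qed

end

context evaluation_module
begin

lemma x_eigenvector:
  assumes "standard i j" and "n \<le> d"
  shows "\<exists>w. w \<noteq> 0 \<and> x i j w = q powi (int d - 2 * int n) *s w"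
proof -
  have "q powi (int d - 2 * int n) \<in> eigenvalues (x i j)"
    using assms diameter_type_1 by (auto simp: diameter_type_def)
  then show ?thesis by (simp add: eigenvalues_def)
qed

lemma x_eigenbasis:
  assumes q: "not_root_of_unity q" and "indexed_basis d v" and "standard i j"
  obtains e where "indexed_basis d e"
    and "\<And>n. n \<le> d \<Longrightarrow> x i j (e n) = q powi (int d - 2 * int n) *s e n"
proof -
  have "\<forall>n. \<exists>w. n \<le> d \<longrightarrow> w \<noteq> 0 \<and> x i j w = q powi (int d - 2 * int n) *s w"
    using x_eigenvector[OF \<open>standard i j\<close>] by blast
  then obtain e where e: "\<forall>n. n \<le> d \<longrightarrow> e n \<noteq> 0 \<and> x i j (e n) = q powi (int d - 2 * int n) *s e n"
    by metis
  show thesis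
  proof (rule that)
    show "indexed_basis d e"
      by (rule eigenbasis[OF assms(2) linear_x[OF assms(3)],
            where lam = "\<lambda>n. q powi (int d - 2 * int n)"])
        (use e in \<open>auto simp: inj_on_def powi_eq_iff[OF q]\<close>)
  qed (use e in blast)
qed

lemma flag_0_eigenvector:
  assumes "h \<in> flag d j 0"
  shows "x j (j + 1) h = q powi int d *s h"
proof -
  have lin: "Vector_Spaces.linear scale scale (x j (j + 1))"
    by (rule linear_x) (simp add: standard_def)
  have "subspace {v. x j (j + 1) v = q powi int d *s v}"
    by (rule subspaceI) (auto simp: endo.linear_0[OF lin] endo.linear_add[OF lin]
        endo.linear_scale[OF lin] scale_right_distrib mult.commute)
  moreover have "flag d j 0 = span {v. x j (j + 1) v = q powi int d *s v}"
    by (simp add: flag_def decomp_def eigenspace_def standard_def)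
  ultimately show ?thesis
    using assms by (simp add: span_eq_iff[THEN iffD2])
qed

text \<open>This is the part of the independence of the flag \<open>[j]\<close> from the chosen decomposition that concerns
  its first component. By \<open>q_weyl_shift\<close>, any deviation would be an eigenvector of \<open>x j (j+1)\<close>
  for \<open>q ^ (d + 2)\<close>, which is not an eigenvalue.\<close>

lemma flag_0_lowest:
  assumes q: "not_root_of_unity q" and h: "h \<in> flag d j 0" and "j - i = 1 \<or> j - i = 2"
  shows "x i j h = q powi (- int d) *s h"
proof -
  have std: "standard i j" "standard j (j + 1)"
    using assms(3) by (auto simp: standard_def)
  define w where "w = x i j h - inverse (q powi int d) *s h"
  have "x j (j + 1) w = (q\<^sup>2 * q powi int d) *s w"
    unfolding w_def
    by (rule q_weyl_shift) (use q_weyl_x[OF q, of j i "j + 1"] assms(3) q linear_x std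
        flag_0_eigenvector[OF h] in auto)
  also have "q\<^sup>2 * q powi int d = q powi (int d + 2)"
    using q by (simp add: power_int_add)
  finally have "w = 0 \<or> q powi (int d + 2) \<in> eigenvalues (x j (j + 1))"
    by (auto simp: eigenvalues_def)
  moreover have "q powi (int d + 2) \<notin> eigenvalues (x j (j + 1))"
    using diameter_type_1 std(2) by (auto simp: diameter_type_def powi_eq_iff[OF q])
  ultimately show ?thesis
    by (simp add: w_def power_int_minus)
qed

lemma antipodal_pair_x:
  assumes q: "not_root_of_unity q" and e: "indexed_basis d e"
    and x_e: "\<And>n. n \<le> d \<Longrightarrow> x k (k + 2) (e n) = q powi (int d - 2 * int n) *s e n"
    and h: "h \<noteq> 0" "h \<in> flag d (k + 1) 0" and h': "h' \<noteq> 0" "h' \<in> flag d (k + 3) 0"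
  shows "antipodal_pair scale q d (x k (k + 2)) (x (k + 2) k) (x k (k + 1)) (x (k + 1) (k + 2))
    (x (k + 2) (k + 3)) (x (k + 3) k) e h h'"
proof (intro antipodal_pair.intro antipodal_pair_axioms.intro)
  show "vspace scale" by unfold_locales
  have std: "standard k (k + 2)" "standard (k + 2) k" "standard k (k + 1)"
    "standard (k + 1) (k + 2)" "standard (k + 2) (k + 3)" "standard (k + 3) k"
    by (simp_all add: standard_def)
  show "Vector_Spaces.linear scale scale (x k (k + 2))"
    "Vector_Spaces.linear scale scale (x (k + 2) k)"
    "Vector_Spaces.linear scale scale (x k (k + 1))"
    "Vector_Spaces.linear scale scale (x (k + 1) (k + 2))"
    "Vector_Spaces.linear scale scale (x (k + 2) (k + 3))"
    "Vector_Spaces.linear scale scale (x (k + 3) k)"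
    by (rule linear_x, rule std)+
  show "q_weyl q (x (k + 2) k) (x k (k + 1))" "q_weyl q (x (k + 1) (k + 2)) (x (k + 2) k)"
    "q_weyl q (x (k + 3) k) (x k (k + 2))" "q_weyl q (x k (k + 2)) (x (k + 2) (k + 3))"
    "q_weyl q (x (k + 3) k) (x k (k + 1))"
    by (rule q_weyl_x[OF q]; simp)+
  show "x (k + 2) k (e n) = q powi (2 * int n - int d) *s e n" if n: "n \<le> d" for n
  proof -
    have "e n = q powi (int d - 2 * int n) *s x (k + 2) k (e n)"
      using rel_inverse[of k "k + 2" "e n"] x_e[OF n] endo.linear_scale[OF linear_x[OF std(2)]]
      by simp
    then have "q powi (2 * int n - int d) *s e n =
        (q powi (2 * int n - int d) * q powi (int d - 2 * int n)) *s x (k + 2) k (e n)"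
      by (metis scale_scale)
    also have "q powi (2 * int n - int d) * q powi (int d - 2 * int n) = 1"
      using q by (simp flip: power_int_add)
    finally show ?thesis by simp
  qed
  show "x k (k + 1) h = q powi (- int d) *s h"
    by (rule flag_0_lowest[OF q h(2)]) simp
  show "x (k + 1) (k + 2) h = q powi int d *s h"
    using flag_0_eigenvector[OF h(2)] by (simp add: add.assoc)
  show "x (k + 2) (k + 3) h' = q powi (- int d) *s h'"
    by (rule flag_0_lowest[OF q h'(2)]) simp
  show "x (k + 3) k h' = q powi int d *s h'"
    using flag_0_eigenvector[OF h'(2)] by (simp add: add.assoc)
qed (fact q e x_e h(1) h'(1))+

end

section \<open>Entries of the defining matrices\<close>

lemma antidiag_mat_cong:
  "(\<And>i. i \<le> d \<Longrightarrow> f i = g i) \<Longrightarrow> antidiag_mat d f = antidiag_mat d g"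
  by (auto simp: antidiag_mat_def intro!: eq_matI)

lemma Z_mat_conj:
  assumes "M \<in> carrier_mat (d + 1) (d + 1)" and "i \<le> d" and "j \<le> d"
  shows "(Z_mat d * M * Z_mat d) $$ (i, j) = M $$ (d - i, d - j)"
proof -
  have Z: "Z_mat d $$ (k, l) = (if k + l = d then 1 else 0)" if "k \<le> d" "l \<le> d" for k l
    using that by (simp add: Z_mat_def antidiag_mat_def)
  have dim: "dim_row (Z_mat d :: 'a mat) = d + 1" "dim_col (Z_mat d :: 'a mat) = d + 1"
    by (simp_all add: Z_mat_def antidiag_mat_def)
  have ZM: "(Z_mat d * M) $$ (i, l) = M $$ (d - i, l)" if "l \<le> d" for l
  proof -
    have "(Z_mat d * M) $$ (i, l) = (\<Sum>k\<in>{0..<d + 1}. Z_mat d $$ (i, k) * M $$ (k, l))"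
      using assms that by (simp add: dim scalar_prod_def)
    also have "\<dots> = (\<Sum>k\<in>{0..<d + 1}. if k = d - i then M $$ (k, l) else 0)"
      using assms by (intro sum.cong) (auto simp: Z)
    finally show ?thesis using assms by simp
  qed
  have "(Z_mat d * M * Z_mat d) $$ (i, j) =
      (\<Sum>k\<in>{0..<d + 1}. (Z_mat d * M) $$ (i, k) * Z_mat d $$ (k, j))"
    using assms by (simp add: dim scalar_prod_def)
  also have "\<dots> = (\<Sum>k\<in>{0..<d + 1}. if k = d - j then M $$ (d - i, k) else 0)"
    using assms by (intro sum.cong) (auto simp: Z ZM)
  finally show ?thesis using assms by simp
qed

lemma Z_E_Z_entry:
  assumes "i \<le> d" and "n \<le> d"
  shows "(Z_mat d * E_mat d (inverse q) * Z_mat d) $$ (i, n) =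
    (if i = n then q powi (2 * int n - int d)
     else if i = Suc n then q powi (- int d) - q powi (2 * int n + 2 - int d) else 0)"
proof -
  have E: "E_mat d (inverse q) \<in> carrier_mat (d + 1) (d + 1)" by (simp add: E_mat_def)
  have index: "d - i = d - n \<longleftrightarrow> i = n" "d - n = d - i + 1 \<longleftrightarrow> i = Suc n"
    using assms by auto
  have entry: "E_mat d (inverse q) $$ (d - i, d - n) =
      (if d - i = d - n then inverse q powi (2 * int (d - i) - int d)
       else if d - n = d - i + 1 then inverse q powi int d - inverse q powi (2 * int (d - n) - 2 - int d)
       else 0)"
    by (simp add: E_mat_def)
  have "(Z_mat d * E_mat d (inverse q) * Z_mat d) $$ (i, n) =
      (if i = n then inverse q powi (2 * int (d - i) - int d)
       else if i = Suc n then inverse q powi int d - inverse q powi (2 * int (d - n) - 2 - int d)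
       else 0)"
    unfolding Z_mat_conj[OF E assms] entry index ..
  then show ?thesis
    using assms by (simp add: powi_inverse of_nat_diff algebra_simps del: power_int_of_nat)
qed

lemma Z_G_Z_entry:
  assumes "i \<le> d" and "n \<le> d"
  shows "(Z_mat d * G_mat d (inverse q) t * Z_mat d) $$ (i, n) =
    (if i = n then q powi (2 * int n - int d)
     else if i = Suc n then (q powi (- int d) - q powi (2 * int n + 2 - int d)) *
       (1 - t * q powi (int d - 2 * int n - 1)) else 0)"
proof -
  have G: "G_mat d (inverse q) t \<in> carrier_mat (d + 1) (d + 1)" by (simp add: G_mat_def)
  have index: "d - i = d - n \<longleftrightarrow> i = n" "d - n = d - i + 1 \<longleftrightarrow> i = Suc n"
    using assms by auto
  have entry: "G_mat d (inverse q) t $$ (d - i, d - n) =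
      (if d - i = d - n then inverse q powi (2 * int (d - i) - int d)
       else if d - n = d - i + 1 then
         (inverse q powi int d - inverse q powi (2 * int (d - n) - 2 - int d)) *
         (1 - t * inverse q powi (int d - 2 * int (d - n) + 1))
       else 0)"
    by (simp add: G_mat_def)
  have "(Z_mat d * G_mat d (inverse q) t * Z_mat d) $$ (i, n) =
      (if i = n then inverse q powi (2 * int (d - i) - int d)
       else if i = Suc n then (inverse q powi int d - inverse q powi (2 * int (d - n) - 2 - int d)) *
         (1 - t * inverse q powi (int d - 2 * int (d - n) + 1))
       else 0)"
    unfolding Z_mat_conj[OF G assms] entry index ..
  moreover have "- (int d - 2 * int (d - n) + 1) = int d - 2 * int n - 1"
    "- (2 * int (d - n) - 2 - int d) = 2 * int n + 2 - int d"
    "i = n \<Longrightarrow> - (2 * int (d - i) - int d) = 2 * int n - int d"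
    using assms by (simp_all add: of_nat_diff)
  ultimately show ?thesis
    by (simp only: powi_inverse cong: if_cong)
qed

section \<open>Comparison of the two exchange maps of an evaluation module\<close>

text \<open>An evaluation module together with the basis \<open>v\<close> that realizes \<open>\<^bold>V\<^sub>d(t)\<close>, eigenbases \<open>e\<close>
  and \<open>e'\<close> of \<open>x 1 3\<close> and \<open>x 0 2\<close>, and the flag vectors. The four operators given on \<open>v\<close> are those from
  which the ratios and the scalar between the two exchange maps are read off.\<close>

locale framed_evaluation_module = evaluation_module scale q x d
  for scale :: "'f::field \<Rightarrow> 'v::ab_group_add \<Rightarrow> 'v" (infixr "*s" 75)
    and q :: 'f and x :: "4 \<Rightarrow> 4 \<Rightarrow> 'v \<Rightarrow> 'v" and d :: nat +
  fixes t :: 'f and \<eta> :: "4 \<Rightarrow> 'v" and v e e' :: "nat \<Rightarrow> 'v"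
  assumes q: "not_root_of_unity q" and t: "t \<noteq> 0"
    and t_generic: "\<And>n. 1 \<le> n \<Longrightarrow> n \<le> d \<Longrightarrow> t \<noteq> q powi (int d - 2 * int n + 1)"
    and \<eta>_nonzero: "\<eta> j \<noteq> 0" and \<eta>_flag: "\<eta> j \<in> flag d j 0"
    and basis_v: "indexed_basis d v"
    and x_23: "n \<le> d \<Longrightarrow> x 2 3 (v n) = q powi (int d - 2 * int n) *s v n"
    and x_31: "n \<le> d \<Longrightarrow> x 3 1 (v n) = q powi (2 * int n - int d) *s v n +
      (if n < d then (q powi (- int d) - q powi (2 * int n + 2 - int d)) *s v (Suc n) else 0)"
    and x_30: "n \<le> d \<Longrightarrow> x 3 0 (v n) = q powi (2 * int n - int d) *s v n +
      (if n < d then ((q powi (- int d) - q powi (2 * int n + 2 - int d)) *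
         (1 - t * q powi (int d - 2 * int n - 1))) *s v (Suc n) else 0)"
    and x_02: "n \<le> d \<Longrightarrow> x 0 2 (v n) = q powi (2 * int n - int d) *s v n +
      (if n = 0 then 0 else ((q powi int d - q powi (2 * int n - 2 - int d)) *
         inverse (1 - t * q powi (int d - 2 * int n + 1))) *s v (n - 1))"
    and basis_e: "indexed_basis d e"
    and x_13_e: "n \<le> d \<Longrightarrow> x 1 3 (e n) = q powi (int d - 2 * int n) *s e n"
    and basis_e': "indexed_basis d e'"
    and x_02_e': "n \<le> d \<Longrightarrow> x 0 2 (e' n) = q powi (int d - 2 * int n) *s e' n"
begin

sublocale odd: antipodal_pair scale q d "x 1 3" "x 3 1" "x 1 2" "x 2 3" "x 3 0" "x 0 1" e "\<eta> 2" "\<eta> 0"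
  using antipodal_pair_x[OF q basis_e, of 1 "\<eta> 2" "\<eta> 0"] x_13_e \<eta>_nonzero \<eta>_flag
  by simp

sublocale even: antipodal_pair scale q d "x 0 2" "x 2 0" "x 0 1" "x 1 2" "x 2 3" "x 3 0" e' "\<eta> 1" "\<eta> 3"
  using antipodal_pair_x[OF q basis_e', of 0 "\<eta> 1" "\<eta> 3"] x_02_e' \<eta>_nonzero \<eta>_flag
  by simp

lemma linear_x_23: "Vector_Spaces.linear scale scale (x 2 3)"
  and linear_x_31: "Vector_Spaces.linear scale scale (x 3 1)"
  and linear_x_30: "Vector_Spaces.linear scale scale (x 3 0)"
  and linear_x_02: "Vector_Spaces.linear scale scale (x 0 2)"
  and linear_x_01: "Vector_Spaces.linear scale scale (x 0 1)"
  and linear_x_13: "Vector_Spaces.linear scale scale (x 1 3)"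
  by (simp_all add: linear_x standard_def)

text \<open>The flag vectors \<open>\<eta> 2\<close>, \<open>\<eta> 3\<close> and \<open>\<eta> 1\<close> are multiples of \<open>v 0\<close>, \<open>v d\<close> and the sum of all \<open>v n\<close>. The
  factors cancel in the end, but the given \<open>\<eta>\<close> are arbitrary, so that they have to be carried along.\<close>

definition \<alpha> :: 'f where "\<alpha> = coord d v (\<eta> 2) 0"
definition \<beta> :: 'f where "\<beta> = coord d v (\<eta> 3) d"
definition \<gamma> :: 'f where "\<gamma> = coord d v (\<eta> 1) 0"

lemma eta_2: "\<eta> 2 = \<alpha> *s v 0"
  unfolding \<alpha>_def
  by (rule eigenvector_multiple[OF basis_v linear_x_23 x_23 odd.inj_eigenvalues])
    (use flag_0_eigenvector[OF \<eta>_flag, of 2] in simp_all)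

lemma eta_3: "\<eta> 3 = \<beta> *s v d"
  unfolding \<beta>_def
  by (rule eigenvector_multiple[OF basis_v linear_x_23 x_23 odd.inj_eigenvalues])
    (use flag_0_lowest[OF q \<eta>_flag, of 3 2] in simp_all)

lemma odd_step_nonzero: "q powi (- int d) - q powi (2 * int i + 2 - int d) \<noteq> 0"
  by (simp add: powi_eq_iff[OF q])

lemma eta_1: "\<eta> 1 = \<gamma> *s (\<Sum>n\<le>d. v n)"
proof -
  have "coord d v (\<eta> 1) n = \<gamma>" if "n \<le> d" for n
    using that
  proof (induction n)
    case (Suc n)
    have "(q powi (- int d) - q powi (2 * int n + 2 - int d)) * coord d v (\<eta> 1) n =
        (q powi (- int d) - q powi (2 * int (Suc n) - int d)) * coord d v (\<eta> 1) (Suc n)"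
      by (rule lower_bidiagonal_eigenvector[OF basis_v linear_x_31 x_31])
        (use Suc.prems flag_0_lowest[OF q \<eta>_flag, of 1 3] in auto)
    moreover have "2 * int (Suc n) - int d = 2 * int n + 2 - int d" by simp
    ultimately have "coord d v (\<eta> 1) n = coord d v (\<eta> 1) (Suc n)"
      by (simp only: mult_left_cancel[OF odd_step_nonzero])
    then show ?case using Suc by simp
  qed (simp add: \<gamma>_def)
  then have "(\<Sum>n\<le>d. coord d v (\<eta> 1) n *s v n) = \<gamma> *s (\<Sum>n\<le>d. v n)"
    by (simp add: scale_sum_right)
  then show ?thesis by (simp add: sum_coord[OF basis_v])
qed

lemma alpha_nonzero: "\<alpha> \<noteq> 0" and beta_nonzero: "\<beta> \<noteq> 0" and gamma_nonzero: "\<gamma> \<noteq> 0"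
  using \<eta>_nonzero[of 2] \<eta>_nonzero[of 3] \<eta>_nonzero[of 1] eta_2 eta_3 eta_1 by auto

lemma odd_coord_step:
  assumes "i < d" and "n \<le> d"
  shows "(q powi (2 * int n - int d) - q powi (2 * int i - int d)) * coord d odd.u (v i) n =
    (q powi (- int d) - q powi (2 * int i + 2 - int d)) * coord d odd.u (v (Suc i)) n"
  by (rule coord_bidiagonal[OF odd.basis_u linear_x_31 odd.A'_u])
    (use assms in \<open>simp_all add: x_31\<close>)

text \<open>The operator \<open>x 3 1\<close> is lower triangular on \<open>v\<close>, and hence so is the transition to its eigenbasis.\<close>

lemma odd_coord_vanish:
  assumes "n < i" and "i \<le> d"
  shows "coord d odd.u (v i) n = 0"
  using assms
proof (induction i)
  case (Suc i)
  have "(q powi (2 * int n - int d) - q powi (2 * int i - int d)) * coord d odd.u (v i) n = 0"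
    using Suc by (cases "i = n") auto
  then show ?case
    using odd_coord_step[of i n] Suc.prems odd_step_nonzero[of i] by simp
qed simp

lemma odd_coord_v_0: "n \<le> d \<Longrightarrow> coord d odd.u (v 0) n = inverse \<alpha>"
  using odd.coord_u_\<eta>[of n] alpha_nonzero arg_cong[OF eta_2, of "\<lambda>w. coord d odd.u w n"]
  by (simp add: coord_scale[OF odd.basis_u] field_simps)

text \<open>The ratio is read off from the first two coordinates of \<open>\<eta> 0\<close> in the basis \<open>v\<close>, which are related
  by the eigenvector equation of \<open>x 3 0\<close>; this is where \<open>t\<close> enters.\<close>

lemma odd_c_1:
  assumes "1 \<le> d"
  shows "odd.c 1 = odd.c 0 * (t * q ^ (d - 1))"
proof -
  have nonzero: "q powi (- int d) - q powi (2 - int d) \<noteq> 0"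
    using odd_step_nonzero[of 0] by simp
  define g where "g n = coord d v (\<eta> 0) n" for n
  have "((q powi (- int d) - q powi (2 * int 0 + 2 - int d)) *
      (1 - t * q powi (int d - 2 * int 0 - 1))) * g 0 =
    (q powi (- int d) - q powi (2 * int (Suc 0) - int d)) * g (Suc 0)"
    unfolding g_def
    by (rule lower_bidiagonal_eigenvector[OF basis_v linear_x_30 x_30])
      (use assms flag_0_lowest[OF q \<eta>_flag, of 0 3] in auto)
  moreover have "q powi (int d - 1) = q ^ (d - 1)"
    using assms by (simp add: power_int_def nat_diff_distrib)
  ultimately have "(q powi (- int d) - q powi (2 - int d)) * ((1 - t * q ^ (d - 1)) * g 0) =
      (q powi (- int d) - q powi (2 - int d)) * g 1"
    by (simp add: mult.assoc)
  then have g_1: "g 1 = (1 - t * q ^ (d - 1)) * g 0"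
    by (simp only: mult_left_cancel[OF nonzero])
  have c: "odd.c n = (\<Sum>i\<le>d. g i * coord d odd.u (v i) n)" if "n \<le> d" for n
  proof -
    have "odd.c n = coord d odd.u (\<Sum>i\<le>d. g i *s v i) n"
      using odd.coord_u_\<eta>'[OF that] by (simp add: g_def sum_coord[OF basis_v])
    then show ?thesis
      by (simp add: coord_sum[OF odd.basis_u] coord_scale[OF odd.basis_u])
  qed
  have "odd.c 0 = (\<Sum>i\<le>d. if i = 0 then g 0 * inverse \<alpha> else 0)"
    unfolding c[OF le0]
    by (intro sum.cong) (auto simp: odd_coord_v_0 odd_coord_vanish)
  then have c_0: "odd.c 0 = g 0 * inverse \<alpha>" by simp
  have "(q powi (2 - int d) - q powi (- int d)) * inverse \<alpha> =
      (q powi (- int d) - q powi (2 - int d)) * coord d odd.u (v 1) 1"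
    using odd_coord_step[of 0 1] odd_coord_v_0[of 1] assms by simp
  then have "(q powi (- int d) - q powi (2 - int d)) * (- inverse \<alpha>) =
      (q powi (- int d) - q powi (2 - int d)) * coord d odd.u (v 1) 1"
    by (simp add: algebra_simps)
  then have v_1: "coord d odd.u (v 1) 1 = - inverse \<alpha>"
    by (simp only: mult_left_cancel[OF nonzero])
  have "odd.c 1 = (\<Sum>i\<le>d. (if i = 0 then g 0 * inverse \<alpha> else 0) +
      (if i = 1 then - (g 1 * inverse \<alpha>) else 0))"
    unfolding c[OF assms]
  proof (intro sum.cong refl)
    fix i assume "i \<in> {..d}"
    then show "g i * coord d odd.u (v i) 1 = (if i = 0 then g 0 * inverse \<alpha> else 0) +
        (if i = 1 then - (g 1 * inverse \<alpha>) else 0)"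
      using v_1 odd_coord_v_0[OF assms] odd_coord_vanish[of 1 i] assms
      by (cases "i = 0"; cases "i = 1") auto
  qed
  then have c_1: "odd.c 1 = (g 0 - g 1) * inverse \<alpha>"
    using assms by (simp add: sum.distrib algebra_simps)
  show ?thesis
    unfolding c_0 c_1 g_1 by (simp add: algebra_simps)
qed

text \<open>The product of the recursion \<open>odd_coord_step\<close> along the whole basis \<open>v\<close>.\<close>

lemma odd_coord_v_d: "coord d odd.u (v d) d = (- 1) ^ d * q ^ (d * (d - 1)) * inverse \<alpha>"
proof -
  have "(\<Prod>i<k. q ^ (2 * d) - q ^ (2 * i)) * inverse \<alpha> =
      (\<Prod>i<k. 1 - q ^ (2 * Suc i)) * coord d odd.u (v k) d" if "k \<le> d" for k
    using that
  proof (induction k)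
    case 0
    then show ?case by (simp add: odd_coord_v_0)
  next
    case (Suc k)
    let ?\<chi> = "\<lambda>k. coord d odd.u (v k) d"
    have scaled: "q ^ d * ((q powi int d - q powi (2 * int k - int d)) * ?\<chi> k) =
        q ^ d * ((q powi (- int d) - q powi (2 * int k + 2 - int d)) * ?\<chi> (Suc k))"
      using odd_coord_step[of k d] Suc.prems by simp
    have left: "q ^ d * (q powi int d - q powi (2 * int k - int d)) = q ^ (2 * d) - q ^ (2 * k)"
    proof -
      have "q powi (2 * int k - int d) = q ^ (2 * k) / q ^ d"
        using powi_nat_diff[of q "2 * k" d] q by simp
      moreover have "q ^ d * q ^ d = q ^ (2 * d)"
        by (simp only: mult_2 power_add)
      ultimately show ?thesis
        using q by (simp add: right_diff_distrib)
    qed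
    have right: "q ^ d * (q powi (- int d) - q powi (2 * int k + 2 - int d)) = 1 - q ^ (2 * Suc k)"
    proof -
      have "2 * int k + 2 - int d = int (2 * Suc k) - int d" by simp
      then have "q powi (2 * int k + 2 - int d) = q ^ (2 * Suc k) / q ^ d"
        by (simp only: powi_nat_diff[OF odd.q_nonzero])
      moreover have "q powi (- int d) = inverse (q ^ d)"
        by (simp add: power_int_minus)
      ultimately show ?thesis
        using q by (simp add: right_diff_distrib del: power_Suc mult_Suc_right)
    qed
    have step: "(q ^ (2 * d) - q ^ (2 * k)) * ?\<chi> k = (1 - q ^ (2 * Suc k)) * ?\<chi> (Suc k)"
      using scaled unfolding mult.assoc[symmetric] left right .
    have "(\<Prod>i<Suc k. q ^ (2 * d) - q ^ (2 * i)) * inverse \<alpha> =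
        (q ^ (2 * d) - q ^ (2 * k)) * ((\<Prod>i<k. q ^ (2 * d) - q ^ (2 * i)) * inverse \<alpha>)"
      by (simp only: prod.lessThan_Suc mult.assoc mult.left_commute)
    also have "\<dots> = (q ^ (2 * d) - q ^ (2 * k)) * ((\<Prod>i<k. 1 - q ^ (2 * Suc i)) * ?\<chi> k)"
      by (rule arg_cong[OF Suc.IH]) (use Suc.prems in simp)
    also have "\<dots> = (\<Prod>i<k. 1 - q ^ (2 * Suc i)) * ((q ^ (2 * d) - q ^ (2 * k)) * ?\<chi> k)"
      by (rule mult.left_commute)
    also have "\<dots> = (\<Prod>i<Suc k. 1 - q ^ (2 * Suc i)) * ?\<chi> (Suc k)"
      by (simp only: step prod.lessThan_Suc mult.assoc)
    finally show ?case .
  qed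
  note recurrence = this
  define P where "P = (\<Prod>i<d. 1 - q ^ (2 * Suc i))"
  have "P * ((- 1) ^ d * q ^ (d * (d - 1)) * inverse \<alpha>) =
      ((- 1) ^ d * q ^ (d * (d - 1)) * P) * inverse \<alpha>"
    by (simp only: mult_ac)
  also have "\<dots> = (\<Prod>i<d. q ^ (2 * d) - q ^ (2 * i)) * inverse \<alpha>"
    by (simp only: prod_q_differences P_def)
  also have "\<dots> = P * coord d odd.u (v d) d"
    unfolding P_def by (rule recurrence) simp
  finally have eq: "P * ((- 1) ^ d * q ^ (d * (d - 1)) * inverse \<alpha>) = P * coord d odd.u (v d) d" .
  have "P \<noteq> 0"
  proof -
    have "1 - q ^ (2 * Suc i) \<noteq> 0" for i
      using q unfolding not_root_of_unity_def right_minus_eq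
      by (metis mult_pos_pos zero_less_Suc zero_less_numeral)
    then show ?thesis
      unfolding P_def prod_zero_iff[OF finite_lessThan] by blast
  qed
  then show ?thesis
    by (rule mult_left_cancel[THEN iffD1, OF _ eq, symmetric])
qed

lemma even_coord_step:
  assumes "0 < i" and "i \<le> d" and "n \<le> d"
  shows "(q powi (int d - 2 * int n) - q powi (2 * int i - int d)) * coord d even.u (v i) n =
    ((q powi int d - q powi (2 * int i - 2 - int d)) *
       inverse (1 - t * q powi (int d - 2 * int i + 1))) * coord d even.u (v (i - 1)) n"
  by (rule coord_bidiagonal[OF even.basis_u linear_x_02 even.A_u])
    (use assms in \<open>simp_all add: x_02\<close>)

lemma t_factor_nonzero:
  assumes "1 \<le> i" and "i \<le> d"
  shows "1 - t * q powi (int d - 2 * int i + 1) \<noteq> 0"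
proof
  assume "1 - t * q powi (int d - 2 * int i + 1) = 0"
  then have "q powi (int d - 2 * int i + 1) * t = 1"
    by (simp add: mult.commute)
  then have "t = q powi (- (int d - 2 * int i + 1))"
    unfolding power_int_minus by (rule inverse_unique[symmetric])
  also have "- (int d - 2 * int i + 1) = int d - 2 * int (d + 1 - i) + 1"
    using assms by (simp add: of_nat_diff)
  finally show False
    using t_generic[of "d + 1 - i"] assms by force
qed

lemma even_step_nonzero:
  assumes "1 \<le> i" and "i \<le> d"
  shows "(q powi int d - q powi (2 * int i - 2 - int d)) *
       inverse (1 - t * q powi (int d - 2 * int i + 1)) \<noteq> 0"
proof -
  have "q powi int d \<noteq> q powi (2 * int i - 2 - int d)"
    unfolding powi_eq_iff[OF q] using assms by simp
  then show ?thesis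
    using t_factor_nonzero[OF assms] by simp
qed

text \<open>On \<open>v\<close> the operator \<open>x 0 2\<close> is upper triangular and its diagonal is that of \<open>x 3 1\<close>; since its
  eigenbasis is numbered in the opposite order, the vanishing coordinates are those left of the
  antidiagonal. The induction runs downwards from \<open>v d\<close>.\<close>

lemma even_coord_vanish:
  assumes "n + i < d"
  shows "coord d even.u (v i) n = 0"
proof -
  have "coord d even.u (v (d - k)) n = 0" if "n < k" "k \<le> d" for k
    using that
  proof (induction k)
    case (Suc k)
    have zero: "(q powi (int d - 2 * int n) - q powi (2 * int (d - k) - int d)) *
        coord d even.u (v (d - k)) n = 0"
      using Suc by (cases "k = n") (auto simp: of_nat_diff)
    have "((q powi int d - q powi (2 * int (d - k) - 2 - int d)) *
        inverse (1 - t * q powi (int d - 2 * int (d - k) + 1))) *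
        coord d even.u (v (d - k - 1)) n = 0"
      by (rule trans[OF even_coord_step[symmetric] zero]) (use Suc.prems in auto)
    then have "coord d even.u (v (d - k - 1)) n = 0"
      unfolding mult_eq_0_iff[of "_ * _" "coord _ _ _ _"]
      using even_step_nonzero[of "d - k"] Suc.prems by auto
    then show ?case by simp
  qed simp
  from this[of "d - i"] show ?thesis using assms by simp
qed

lemma even_c_coord: "n \<le> d \<Longrightarrow> even.c n = \<beta> * coord d even.u (v d) n"
  using even.coord_u_\<eta>'[of n] arg_cong[OF eta_3, of "\<lambda>w. coord d even.u w n"]
  by (simp add: coord_scale[OF even.basis_u])

lemma even_coord_sum:
  assumes "n \<le> d"
  shows "(\<Sum>i\<le>d. coord d even.u (v i) n) = inverse \<gamma>"
  using even.coord_u_\<eta>[OF assms] gamma_nonzero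
    arg_cong[OF eta_1, of "\<lambda>w. coord d even.u w n"]
  by (simp add: coord_scale[OF even.basis_u] coord_sum[OF even.basis_u] field_simps)

lemma even_c_0: "even.c 0 = \<beta> * inverse \<gamma>"
proof -
  have "(\<Sum>i\<le>d. coord d even.u (v i) 0) =
      (\<Sum>i\<le>d. if i = d then coord d even.u (v i) 0 else 0)"
    by (intro sum.cong) (auto simp: even_coord_vanish)
  then show ?thesis
    using even_coord_sum[of 0] by (simp add: even_c_coord)
qed

text \<open>The counterpart of \<open>odd_c_1\<close> at the other end: only \<open>v (d - 1)\<close> and \<open>v d\<close> have a coordinate at
  index 1.\<close>

lemma even_c_1:
  assumes "1 \<le> d"
  shows "even.c 1 = even.c 0 * (inverse t * q ^ (d - 1))"
proof -
  let ?\<psi> = "\<lambda>i. coord d even.u (v i) 1"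
  let ?l = "1 - t * q powi (1 - int d)"
  have l: "?l \<noteq> 0"
    using t_factor_nonzero[of d] assms by simp
  have "(q powi (int d - 2) - q powi int d) * ?\<psi> d =
      ((q powi int d - q powi (int d - 2)) * inverse ?l) * ?\<psi> (d - 1)"
    using even_coord_step[of d 1] assms by simp
  then have "(q powi int d - q powi (int d - 2)) * (- (?l * ?\<psi> d)) =
      (q powi int d - q powi (int d - 2)) * ?\<psi> (d - 1)"
    using l by (simp add: field_simps)
  moreover have "q powi int d - q powi (int d - 2) \<noteq> 0"
    unfolding right_minus_eq powi_eq_iff[OF q] by simp
  ultimately have \<psi>: "?\<psi> (d - 1) = - (?l * ?\<psi> d)"
    by (simp only: mult_cancel_left) simp
  have "(\<Sum>i\<le>d. ?\<psi> i) = (\<Sum>i\<le>d. (if i = d then ?\<psi> d else 0) + (if i = d - 1 then ?\<psi> (d - 1) else 0))"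
  proof (intro sum.cong refl)
    fix i assume "i \<in> {..d}"
    then consider "i = d" | "i = d - 1" | "1 + i < d" by force
    then show "?\<psi> i = (if i = d then ?\<psi> d else 0) + (if i = d - 1 then ?\<psi> (d - 1) else 0)"
      using assms by cases (auto simp: even_coord_vanish)
  qed
  also have "\<dots> = ?\<psi> d + ?\<psi> (d - 1)"
    using assms by (simp add: sum.distrib)
  also have "\<dots> = t * q powi (1 - int d) * ?\<psi> d"
    unfolding \<psi> by (simp add: algebra_simps)
  finally have "t * q powi (1 - int d) * ?\<psi> d = inverse \<gamma>"
    using even_coord_sum[OF assms] by simp
  moreover have "q powi (1 - int d) = inverse (q ^ (d - 1))"
  proof -
    have "1 - int d = - int (d - 1)" using assms by simp
    then show ?thesis by (simp only: power_int_minus power_int_of_nat)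
  qed
  ultimately have "t * inverse (q ^ (d - 1)) * ?\<psi> d = inverse \<gamma>"
    by simp
  moreover have "?\<psi> d = (t * inverse (q ^ (d - 1)) * ?\<psi> d) * (inverse t * q ^ (d - 1))"
    using t q by (simp add: field_simps)
  ultimately have "?\<psi> d = inverse \<gamma> * (inverse t * q ^ (d - 1))"
    by metis
  then show ?thesis
    using assms by (simp add: even_c_coord even_c_0 mult.assoc)
qed

text \<open>Here \<open>s\<close> is the entry of the first matrix at index 0; the
  choice of \<open>\<kappa>\<close> is justified by \<open>X_eta_1\<close>.\<close>

definition s :: 'f where "s = q powi (- int (d choose 2))"

definition \<kappa> :: 'f where "\<kappa> = (- 1) ^ d * t ^ d"
definition \<rho> :: 'f where "\<rho> = t * q ^ (d - 1)"
definition \<rho>' :: 'f where "\<rho>' = inverse t * q ^ (d - 1)"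

sublocale odd: geometric_antipodal_pair scale q d "x 1 3" "x 3 1" "x 1 2" "x 2 3" "x 3 0" "x 0 1"
  e "\<eta> 2" "\<eta> 0" \<rho> s
  by unfold_locales (use odd_c_1 t q in \<open>auto simp: s_def \<rho>_def\<close>)

sublocale even: geometric_antipodal_pair scale q d "x 0 2" "x 2 0" "x 0 1" "x 1 2" "x 2 3" "x 3 0"
  e' "\<eta> 1" "\<eta> 3" \<rho>' "\<kappa> * s"
  by unfold_locales (use even_c_1 t q in \<open>auto simp: s_def \<rho>'_def \<kappa>_def\<close>)

text \<open>Both values are multiples of \<open>\<eta> 3\<close>: on one side because \<open>\<eta> 1\<close> and \<open>\<eta> 3\<close> span the extreme
  components of \<open>[1,3]\<close>, on the other side by \<open>even.X_\<eta>\<close>. The normalization \<open>\<kappa>\<close> of the even map is the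
  one for which the multiples coincide.\<close>

lemma X_eta_1: "odd.X (\<eta> 1) = even.X (\<eta> 1)"
proof -
  have "\<eta> 1 = coord d odd.u (\<eta> 1) 0 *s odd.u 0"
    by (rule eigenvector_multiple[OF odd.basis_u linear_x_31 odd.A'_u odd.inj_eigenvalues'])
      (use flag_0_lowest[OF q \<eta>_flag, of 1 3] in simp_all)
  moreover have "coord d odd.u (\<eta> 1) 0 = \<gamma> * inverse \<alpha>"
  proof -
    have "(\<Sum>i\<le>d. coord d odd.u (v i) 0) = (\<Sum>i\<le>d. if i = 0 then inverse \<alpha> else 0)"
      by (intro sum.cong) (auto simp: odd_coord_v_0 odd_coord_vanish)
    then show ?thesis
      by (simp add: eta_1 coord_scale[OF odd.basis_u] coord_sum[OF odd.basis_u])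
  qed
  ultimately have 1: "\<eta> 1 = (\<gamma> * inverse \<alpha>) *s odd.u 0" by simp
  have "\<eta> 3 = coord d odd.u (\<eta> 3) d *s odd.u d"
    by (rule eigenvector_multiple[OF odd.basis_u linear_x_13 odd.A_u odd.inj_eigenvalues])
      (use flag_0_lowest[OF q \<eta>_flag, of 3 1] in simp_all)
  then have 3: "\<eta> 3 = (\<beta> * ((- 1) ^ d * q ^ (d * (d - 1)) * inverse \<alpha>)) *s odd.u d"
    by (simp add: eta_3 coord_scale[OF odd.basis_u] odd_coord_v_d)
  have "odd.X (\<eta> 1) = odd.X ((\<gamma> * inverse \<alpha>) *s odd.u 0)"
    by (simp only: 1)
  also have "\<dots> = (\<gamma> * inverse \<alpha> * (s * \<rho> ^ d)) *s odd.u d"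
    by (simp add: odd.X_u[of 0] endo.linear_scale[OF odd.linear_X])
  also have "\<gamma> * inverse \<alpha> * (s * \<rho> ^ d) =
      \<kappa> * s * inverse (even.c 0) * (\<beta> * ((- 1) ^ d * q ^ (d * (d - 1)) * inverse \<alpha>))"
  proof -
    have "(- 1) ^ d * (- 1) ^ d = (1 :: 'f)"
      by (simp flip: power_mult_distrib)
    moreover have "inverse (even.c 0) * \<beta> = \<gamma>"
      using beta_nonzero by (simp add: even_c_0)
    moreover have "(q ^ (d - 1)) ^ d = q ^ (d * (d - 1))"
      by (simp add: mult.commute flip: power_mult)
    ultimately show ?thesis
      by (simp only: power_mult_distrib \<rho>_def \<kappa>_def) (simp add: mult_ac)
  qed
  also have "\<dots> *s odd.u d = (\<kappa> * s * inverse (even.c 0)) *s \<eta> 3"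
    using arg_cong[OF 3, of "\<lambda>w. (\<kappa> * s * inverse (even.c 0)) *s w"]
    by (simp only: scale_scale)
  also have "\<dots> = even.X (\<eta> 1)"
    by (simp only: even.X_\<eta>)
  finally show ?thesis .
qed

lemma linear_eta_1:
  "Vector_Spaces.linear scale scale f \<Longrightarrow> f (\<eta> 1) = \<gamma> *s (\<Sum>n\<le>d. f (v n))"
  by (subst eta_1) (simp add: endo.linear_scale endo.linear_sum)

text \<open>On each \<open>v n\<close> both maps give eigenvectors of \<open>x 0 1\<close> for the same eigenvalue, and the differences
  add up to a multiple of the difference at \<open>\<eta> 1\<close>.\<close>

lemma X_eq: "odd.X = even.X"
proof -
  have odd_X: "x 0 1 (odd.X w) = odd.X (x 2 3 w)" and even_X: "x 0 1 (even.X w) = even.X (x 2 3 w)" for w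
    using fun_cong[OF odd.X_C, of w] fun_cong[OF even.X_D, of w] by simp_all
  have "\<forall>n\<in>{..d}. odd.X (v n) - even.X (v n) = 0"
  proof (rule eigenvectors_sum_zero[OF _ linear_x_01 odd.inj_eigenvalues])
    show "x 0 1 (odd.X (v n) - even.X (v n)) =
        q powi (int d - 2 * int n) *s (odd.X (v n) - even.X (v n))" if "n \<in> {..d}" for n
      using that by (simp add: endo.linear_diff[OF linear_x_01] odd_X even_X x_23
          endo.linear_scale[OF odd.linear_X] endo.linear_scale[OF even.linear_X]
          scale_right_diff_distrib)
    have "\<gamma> *s (\<Sum>n\<le>d. odd.X (v n) - even.X (v n)) = odd.X (\<eta> 1) - even.X (\<eta> 1)"
      by (simp only: linear_eta_1[OF odd.linear_X] linear_eta_1[OF even.linear_X]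
          sum_subtractf scale_right_diff_distrib)
    then show "(\<Sum>n\<le>d. odd.X (v n) - even.X (v n)) = 0"
      using gamma_nonzero by (simp add: X_eta_1)
  qed simp
  then show ?thesis
    by (intro linear_eq_on_indexed_basis[OF basis_v odd.linear_X even.linear_X]) simp
qed

text \<open>The odd map handles all generators except \<open>x 0 2\<close> and \<open>x 2 0\<close>, which are exchanged by the even map.\<close>

lemma exchanger_X: "exchanger odd.X"
proof -
  have swap: "odd.X \<circ> x i j = x (i + 2) (j + 2) \<circ> odd.X" if "standard i j" for i j
  proof -
    have "j = i + 1 \<or> j = i + 2"
      using that by (auto simp: standard_def algebra_simps)
    then show ?thesis
      using four_cases[of i] odd.X_A odd.X_A' odd.X_B odd.X_C odd.X_D odd.X_F
        even.X_A[folded X_eq] even.X_A'[folded X_eq]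
      by auto
  qed
  have "odd.X \<circ> inv_into UNIV odd.X = id"
    using odd.bij_X by (simp add: bij_is_surj flip: surj_iff)
  then have "odd.X \<circ> x i j \<circ> inv_into UNIV odd.X = x (i + 2) (j + 2)" if "standard i j" for i j
    by (simp only: swap[OF that] comp_assoc comp_id)
  then show ?thesis
    using odd.linear_X odd.bij_X unfolding exchanger_def by blast
qed

lemma exponent_up:
  assumes "i \<le> d"
  shows "s * (a * q ^ (d - 1)) ^ i = a ^ i * q powi (int i * (int d - 1) - int (d choose 2))"
proof -
  have "int i * (int d - 1) = int (i * (d - 1))"
    using assms by (cases d) simp_all
  then have "q powi (int i * (int d - 1) - int (d choose 2)) = (q ^ (d - 1)) ^ i * s"
    using q by (simp add: s_def power_int_diff power_int_minus divide_inverse mult.commute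
        del: of_nat_mult flip: power_mult)
  then show ?thesis by (simp add: power_mult_distrib)
qed

text \<open>Replacing \<open>i\<close> by \<open>d - i\<close> negates the exponent of \<open>q\<close>, because \<open>d * (d - 1)\<close> is twice the
  binomial coefficient.\<close>

lemma exponent_down:
  assumes "i \<le> d"
  shows "s * (a * q ^ (d - 1)) ^ (d - i) =
    a ^ (d - i) * q powi (int (d choose 2) - int i * (int d - 1))"
proof -
  have "int (d - i) * (int d - 1) - int (d choose 2) = int (d choose 2) - int i * (int d - 1)"
    using twice_choose_two[of d] assms by (simp add: of_nat_diff algebra_simps)
  then show ?thesis
    using exponent_up[of "d - i" a] by simp
qed

lemma odd_representations:
  shows "represents d (antidiag_mat d (\<lambda>i. s * \<rho> ^ i)) (std_basis d \<eta> k 2 1 3) odd.X"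
    and "represents d (antidiag_mat d (\<lambda>i. s * \<rho> ^ (d - i))) (std_basis d \<eta> k 2 3 1) odd.X"
    and "represents d (antidiag_mat d (\<lambda>i. s * \<rho> ^ i)) (std_basis d \<eta> k 0 3 1) odd.X"
    and "represents d (antidiag_mat d (\<lambda>i. s * \<rho> ^ (d - i))) (std_basis d \<eta> k 0 1 3) odd.X"
proof -
  have std: "standard 1 3" "standard 3 1" by (simp_all add: standard_def)
  show "represents d (antidiag_mat d (\<lambda>i. s * \<rho> ^ i)) (std_basis d \<eta> k 2 1 3) odd.X"
    by (rule represents_std_basis[OF q std(1) odd.basis_u])
      (simp_all add: odd.A_u odd.sum_u odd.X_u)
  show "represents d (antidiag_mat d (\<lambda>i. s * \<rho> ^ (d - i))) (std_basis d \<eta> k 2 3 1) odd.X"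
    by (rule represents_std_basis[OF q std(2) indexed_basis_reverse[OF odd.basis_u]])
      (simp_all add: odd.A'_u_reverse sum_reverse odd.sum_u odd.X_u_reverse)
  show "represents d (antidiag_mat d (\<lambda>i. s * \<rho> ^ i)) (std_basis d \<eta> k 0 3 1) odd.X"
    by (rule represents_std_basis[OF q std(2) indexed_basis_reverse[OF odd.basis_cu]])
      (simp_all add: odd.A'_u_reverse endo.linear_scale[OF odd.linear_A'] scale_left_commute
        sum_reverse[of "\<lambda>n. odd.c n *s odd.u n"] odd.sum_cu odd.X_cu_reverse
        del: scale_scale)
  show "represents d (antidiag_mat d (\<lambda>i. s * \<rho> ^ (d - i))) (std_basis d \<eta> k 0 1 3) odd.X"
    by (rule represents_std_basis[OF q std(1) odd.basis_cu])
      (simp_all add: odd.A_u endo.linear_scale[OF odd.linear_A] scale_left_commute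
        odd.sum_cu odd.X_cu del: scale_scale)
qed

lemma even_representations:
  shows "represents d (antidiag_mat d (\<lambda>i. \<kappa> * s * \<rho>' ^ i)) (std_basis d \<eta> k 1 0 2) even.X"
    and "represents d (antidiag_mat d (\<lambda>i. \<kappa> * s * \<rho>' ^ (d - i))) (std_basis d \<eta> k 1 2 0) even.X"
    and "represents d (antidiag_mat d (\<lambda>i. \<kappa> * s * \<rho>' ^ i)) (std_basis d \<eta> k 3 2 0) even.X"
    and "represents d (antidiag_mat d (\<lambda>i. \<kappa> * s * \<rho>' ^ (d - i))) (std_basis d \<eta> k 3 0 2) even.X"
proof -
  have std: "standard 0 2" "standard 2 0" by (simp_all add: standard_def)
  show "represents d (antidiag_mat d (\<lambda>i. \<kappa> * s * \<rho>' ^ i)) (std_basis d \<eta> k 1 0 2) even.X"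
    by (rule represents_std_basis[OF q std(1) even.basis_u])
      (simp_all add: even.A_u even.sum_u even.X_u)
  show "represents d (antidiag_mat d (\<lambda>i. \<kappa> * s * \<rho>' ^ (d - i))) (std_basis d \<eta> k 1 2 0) even.X"
    by (rule represents_std_basis[OF q std(2) indexed_basis_reverse[OF even.basis_u]])
      (simp_all add: even.A'_u_reverse sum_reverse even.sum_u even.X_u_reverse)
  show "represents d (antidiag_mat d (\<lambda>i. \<kappa> * s * \<rho>' ^ i)) (std_basis d \<eta> k 3 2 0) even.X"
    by (rule represents_std_basis[OF q std(2) indexed_basis_reverse[OF even.basis_cu]])
      (simp_all add: even.A'_u_reverse endo.linear_scale[OF even.linear_A'] scale_left_commute
        sum_reverse[of "\<lambda>n. even.c n *s even.u n"] even.sum_cu even.X_cu_reverse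
        del: scale_scale)
  show "represents d (antidiag_mat d (\<lambda>i. \<kappa> * s * \<rho>' ^ (d - i))) (std_basis d \<eta> k 3 0 2) even.X"
    by (rule represents_std_basis[OF q std(1) even.basis_cu])
      (simp_all add: even.A_u endo.linear_scale[OF even.linear_A] scale_left_commute
        even.sum_cu even.X_cu del: scale_scale)
qed

theorem exchanger_representations:
  "exchanger odd.X \<and>
    represents d (antidiag_mat d (\<lambda>i. t ^ i * q powi (int i * (int d - 1) - int (d choose 2))))
      (std_basis d \<eta> 0 2 1 3) odd.X \<and>
    represents d (antidiag_mat d (\<lambda>i. t ^ (d - i) * q powi (int (d choose 2) - int i * (int d - 1))))
      (std_basis d \<eta> 0 2 3 1) odd.X \<and>
    represents d (antidiag_mat d (\<lambda>i. t ^ i * q powi (int i * (int d - 1) - int (d choose 2))))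
      (std_basis d \<eta> 2 0 3 1) odd.X \<and>
    represents d (antidiag_mat d (\<lambda>i. t ^ (d - i) * q powi (int (d choose 2) - int i * (int d - 1))))
      (std_basis d \<eta> 2 0 1 3) odd.X \<and>
    represents d (antidiag_mat d (\<lambda>i. (- 1) ^ d * t ^ (d - i) * q powi (int i * (int d - 1) - int (d choose 2))))
      (std_basis d \<eta> 1 3 2 0) odd.X \<and>
    represents d (antidiag_mat d (\<lambda>i. (- 1) ^ d * t ^ i * q powi (int (d choose 2) - int i * (int d - 1))))
      (std_basis d \<eta> 1 3 0 2) odd.X \<and>
    represents d (antidiag_mat d (\<lambda>i. (- 1) ^ d * t ^ (d - i) * q powi (int i * (int d - 1) - int (d choose 2))))
      (std_basis d \<eta> 3 1 0 2) odd.X \<and>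
    represents d (antidiag_mat d (\<lambda>i. (- 1) ^ d * t ^ i * q powi (int (d choose 2) - int i * (int d - 1))))
      (std_basis d \<eta> 3 1 2 0) odd.X"
proof -
  have t_cancel: "t ^ d * inverse t ^ i = t ^ (d - i)" if "i \<le> d" for i
    using that t by (simp add: power_diff power_inverse divide_inverse)
  have odd_up: "antidiag_mat d (\<lambda>i. t ^ i * q powi (int i * (int d - 1) - int (d choose 2))) =
      antidiag_mat d (\<lambda>i. s * \<rho> ^ i)"
    unfolding \<rho>_def by (rule antidiag_mat_cong) (rule exponent_up[symmetric])
  have odd_down: "antidiag_mat d (\<lambda>i. t ^ (d - i) * q powi (int (d choose 2) - int i * (int d - 1))) =
      antidiag_mat d (\<lambda>i. s * \<rho> ^ (d - i))"
    unfolding \<rho>_def by (rule antidiag_mat_cong) (rule exponent_down[symmetric])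
  have even_up: "antidiag_mat d (\<lambda>i. (- 1) ^ d * t ^ (d - i) * q powi (int i * (int d - 1) - int (d choose 2))) =
      antidiag_mat d (\<lambda>i. \<kappa> * s * \<rho>' ^ i)"
  proof (rule antidiag_mat_cong)
    fix i assume i: "i \<le> d"
    have "\<kappa> * s * \<rho>' ^ i = (- 1) ^ d * (t ^ d * (s * (inverse t * q ^ (d - 1)) ^ i))"
      by (simp only: \<kappa>_def \<rho>'_def mult.assoc)
    also have "\<dots> = (- 1) ^ d * (t ^ d * inverse t ^ i) *
        q powi (int i * (int d - 1) - int (d choose 2))"
      by (simp only: exponent_up[OF i] mult.assoc)
    finally show "(- 1) ^ d * t ^ (d - i) * q powi (int i * (int d - 1) - int (d choose 2)) =
        \<kappa> * s * \<rho>' ^ i"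
      by (simp only: t_cancel[OF i])
  qed
  have even_down: "antidiag_mat d (\<lambda>i. (- 1) ^ d * t ^ i * q powi (int (d choose 2) - int i * (int d - 1))) =
      antidiag_mat d (\<lambda>i. \<kappa> * s * \<rho>' ^ (d - i))"
  proof (rule antidiag_mat_cong)
    fix i assume i: "i \<le> d"
    have "\<kappa> * s * \<rho>' ^ (d - i) = (- 1) ^ d * (t ^ d * (s * (inverse t * q ^ (d - 1)) ^ (d - i)))"
      by (simp only: \<kappa>_def \<rho>'_def mult.assoc)
    also have "\<dots> = (- 1) ^ d * (t ^ d * inverse t ^ (d - i)) *
        q powi (int (d choose 2) - int i * (int d - 1))"
      by (simp only: exponent_down[OF i] mult.assoc)
    finally show "(- 1) ^ d * t ^ i * q powi (int (d choose 2) - int i * (int d - 1)) =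
        \<kappa> * s * \<rho>' ^ (d - i)"
      using t_cancel[of "d - i"] i by (simp only: diff_le_self diff_diff_cancel)
  qed
  show ?thesis
    unfolding odd_up odd_down even_up even_down
    by (intro conjI exchanger_X odd_representations even_representations[folded X_eq])
qed

end

text \<open>Of the eight representing matrices in the definition of the evaluation parameter, the frame takes up
  \<open>K\<close>, \<open>Z E Z\<close>, \<open>Z G Z\<close> and \<open>L\<close>; the eigenbases exist because all eigenvalues
  \<open>q powi (d - 2 * n)\<close> occur.\<close>

lemma (in evaluation_module) evaluation_parameter_framed:
  assumes q: "not_root_of_unity q" and "evaluation_parameter t"
    and "\<And>j. \<eta> j \<noteq> 0 \<and> \<eta> j \<in> flag d j 0"
  shows "\<exists>v e e'. framed_evaluation_module scale q x d t \<eta> v e e'"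
proof -
  obtain v where t: "t \<noteq> 0" "t \<notin> {q powi (int d - 2 * int n + 1) | n. 1 \<le> n \<and> n \<le> d}"
    and K: "represents d (K_mat d q) v (x 2 3)"
    and E: "represents d (Z_mat d * E_mat d (inverse q) * Z_mat d) v (x 3 1)"
    and G: "represents d (Z_mat d * G_mat d (inverse q) t * Z_mat d) v (x 3 0)"
    and L: "represents d (L_mat d q t) v (x 0 2)"
    using assms(2) unfolding evaluation_parameter_def by blast
  have v: "indexed_basis d v"
    using K by (simp add: represents_def)
  have std: "standard 1 3" "standard 0 2" by (simp_all add: standard_def)
  obtain e where e: "indexed_basis d e"
    "\<And>n. n \<le> d \<Longrightarrow> x 1 3 (e n) = q powi (int d - 2 * int n) *s e n"
    using x_eigenbasis[OF q v std(1)] by blast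
  obtain e' where e': "indexed_basis d e'"
    "\<And>n. n \<le> d \<Longrightarrow> x 0 2 (e' n) = q powi (int d - 2 * int n) *s e' n"
    using x_eigenbasis[OF q v std(2)] by blast
  have "framed_evaluation_module scale q x d t \<eta> v e e'"
  proof (intro framed_evaluation_module.intro framed_evaluation_module_axioms.intro)
    show "evaluation_module scale q x d" by unfold_locales
    show "t \<noteq> q powi (int d - 2 * int n + 1)" if "1 \<le> n" "n \<le> d" for n
      using t(2) that by blast
    show "x 2 3 (v n) = q powi (int d - 2 * int n) *s v n" if "n \<le> d" for n
      by (rule represents_diagonal[OF K that]) (use that in \<open>simp add: K_mat_def\<close>)
    show "x 3 1 (v n) = q powi (2 * int n - int d) *s v n +
        (if n < d then (q powi (- int d) - q powi (2 * int n + 2 - int d)) *s v (Suc n) else 0)"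
      if "n \<le> d" for n
      by (rule represents_lower_bidiagonal[OF E that]) (rule Z_E_Z_entry[OF _ that])
    show "x 3 0 (v n) = q powi (2 * int n - int d) *s v n +
        (if n < d then ((q powi (- int d) - q powi (2 * int n + 2 - int d)) *
           (1 - t * q powi (int d - 2 * int n - 1))) *s v (Suc n) else 0)" if "n \<le> d" for n
      by (rule represents_lower_bidiagonal[OF G that]) (rule Z_G_Z_entry[OF _ that])
    show "x 0 2 (v n) = q powi (2 * int n - int d) *s v n +
        (if n = 0 then 0 else ((q powi int d - q powi (2 * int n - 2 - int d)) *
           inverse (1 - t * q powi (int d - 2 * int n + 1))) *s v (n - 1))" if "n \<le> d" for n
      by (rule represents_upper_bidiagonal[OF L that]) (use that in \<open>simp add: L_mat_def\<close>)
  qed (use assms(1,3) t v e e' in blast)+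
  then show ?thesis by blast
qed

section \<open>The exchanger\<close>

theorem theorem15p11:
  fixes scale :: "'f::alg_closed_field \<Rightarrow> 'v::ab_group_add \<Rightarrow> 'v"
    and q t :: 'f
    and x :: "4 \<Rightarrow> 4 \<Rightarrow> 'v \<Rightarrow> 'v"
    and d :: nat
    and \<eta> :: "4 \<Rightarrow> 'v"
  assumes "q \<noteq> 0" and "\<forall>n>0. q ^ n \<noteq> 1"
    and "evaluation_module scale q x d"
    and "evaluation_module.evaluation_parameter scale q x d t"
    and "\<forall>j. \<eta> j \<noteq> 0 \<and> \<eta> j \<in> qtet_module.flag scale q x d j 0"
  shows "\<exists>X. qtet_module.exchanger scale x X \<and>
    vspace.represents scale d
      (antidiag_mat d (\<lambda>i. t ^ i * q powi (int i * (int d - 1) - int (d choose 2))))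
      (qtet_module.std_basis scale q x d \<eta> 0 2 1 3) X \<and>
    vspace.represents scale d
      (antidiag_mat d (\<lambda>i. t ^ (d - i) * q powi (int (d choose 2) - int i * (int d - 1))))
      (qtet_module.std_basis scale q x d \<eta> 0 2 3 1) X \<and>
    vspace.represents scale d
      (antidiag_mat d (\<lambda>i. t ^ i * q powi (int i * (int d - 1) - int (d choose 2))))
      (qtet_module.std_basis scale q x d \<eta> 2 0 3 1) X \<and>
    vspace.represents scale d
      (antidiag_mat d (\<lambda>i. t ^ (d - i) * q powi (int (d choose 2) - int i * (int d - 1))))
      (qtet_module.std_basis scale q x d \<eta> 2 0 1 3) X \<and>
    vspace.represents scale d
      (antidiag_mat d (\<lambda>i. (- 1) ^ d * t ^ (d - i) * q powi (int i * (int d - 1) - int (d choose 2))))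
      (qtet_module.std_basis scale q x d \<eta> 1 3 2 0) X \<and>
    vspace.represents scale d
      (antidiag_mat d (\<lambda>i. (- 1) ^ d * t ^ i * q powi (int (d choose 2) - int i * (int d - 1))))
      (qtet_module.std_basis scale q x d \<eta> 1 3 0 2) X \<and>
    vspace.represents scale d
      (antidiag_mat d (\<lambda>i. (- 1) ^ d * t ^ (d - i) * q powi (int i * (int d - 1) - int (d choose 2))))
      (qtet_module.std_basis scale q x d \<eta> 3 1 0 2) X \<and>
    vspace.represents scale d
      (antidiag_mat d (\<lambda>i. (- 1) ^ d * t ^ i * q powi (int (d choose 2) - int i * (int d - 1))))
      (qtet_module.std_basis scale q x d \<eta> 3 1 2 0) X"
proof -
  interpret evaluation_module scale q x d by fact
  have "not_root_of_unity q"
    using assms(1,2) by (simp add: not_root_of_unity_def)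
  then obtain v e e' where "framed_evaluation_module scale q x d t \<eta> v e e'"
    using evaluation_parameter_framed assms(4,5) by blast
  then interpret framed_evaluation_module scale q x d t \<eta> v e e' .
  show ?thesis
    by (rule exI) (rule exchanger_representations)
qed

end
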